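(* Let $K$ be a field and let $G$ be a finite graph on the vertex set $[n]=\{1,\ldots,n\}$ having no loops and no multiple edges. Suppose that the complementary graph $\bar G$ of $G$ is chordal. Then all powers $I(G)^k$, $k\ge1$, of the edge ideal $I(G)\subset S=K[x_1,\ldots,x_n]$ have linear quotients.
   Context: The edge ideal $I(G)$ is generated by the monomials $x_ix_j$ with $\{i,j\}\in E(G)$, where $E(G)$ is the edge set. The complementary graph $\bar G$ is the graph on $[n]$ whose edges are the 2-element subsets $\{i,j\}\subset[n]$ with $\{i,j\}\notin E(G)$. A finite graph is chordal if each of its cycles of length $\ge4$ has a chord. A sequence $f_1,\ldots,f_s$ of homogeneous elements of $S$ with $0<\deg f_1\le\cdots\le\deg f_s$ has linear quotients if for each $2\le j\le s$ the colon ideal $(f_1,\ldots,f_{j-1}):f_j$ is generated by linear forms. A graded ideal has linear quotients if it is generated by a sequence with linear quotients. *)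

theory Defs
  imports "HOL-Algebra.Ideal_Product" "HOL-Library.Poly_Mapping"
begin

subsection \<open>Finite simple graphs on \<open>{1..n}\<close>\<close>

definition simple_graph :: "nat \<Rightarrow> nat set set \<Rightarrow> bool" where
  "simple_graph n E \<longleftrightarrow> (\<forall>e\<in>E. e \<subseteq> {1..n} \<and> card e = 2)"

definition complement_edges :: "nat \<Rightarrow> nat set set \<Rightarrow> nat set set" where
  "complement_edges n E = {e. e \<subseteq> {1..n} \<and> card e = 2 \<and> e \<notin> E}"

text \<open>A cycle of length at least 3 is given by the list of its distinct vertices in cyclic order.\<close>

definition cycle_edges :: "nat list \<Rightarrow> nat set set" where
  "cycle_edges c = {{c ! i, c ! (Suc i mod length c)} | i. i < length c}"

definition is_cycle :: "nat set set \<Rightarrow> nat list \<Rightarrow> bool" where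
  "is_cycle E c \<longleftrightarrow> 3 \<le> length c \<and> distinct c \<and> cycle_edges c \<subseteq> E"

definition is_chord :: "nat set set \<Rightarrow> nat list \<Rightarrow> nat set \<Rightarrow> bool" where
  "is_chord E c e \<longleftrightarrow> e \<in> E \<and> e \<subseteq> set c \<and> e \<notin> cycle_edges c"

definition chordal :: "nat set set \<Rightarrow> bool" where
  "chordal E \<longleftrightarrow> (\<forall>c. is_cycle E c \<and> 4 \<le> length c \<longrightarrow> (\<exists>e. is_chord E c e))"


subsection \<open>The polynomial ring \<open>K[x\<^sub>1, \<dots>, x\<^sub>n]\<close>\<close>

text \<open>
  A polynomial is a finitely supported map from monomials to coefficients, a monomial being a
  finitely supported map from variable indices to exponents. The type has infinitely many
  variables; the carrier below keeps the polynomials in \<open>x\<^sub>1, \<dots>, x\<^sub>n\<close>, and all ideals are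
  ideals of this ring.
\<close>

type_synonym 'k mpoly = "(nat \<Rightarrow>\<^sub>0 nat) \<Rightarrow>\<^sub>0 'k"

definition mpoly_ring :: "nat \<Rightarrow> ('k::field) mpoly ring" where
  "mpoly_ring n = \<lparr>carrier = {f. \<forall>m\<in>Poly_Mapping.keys f. Poly_Mapping.keys m \<subseteq> {1..n}},
                   mult = (*), one = 1, zero = 0, add = (+)\<rparr>"

definition var :: "nat \<Rightarrow> ('k::field) mpoly" where
  "var i = Poly_Mapping.single (Poly_Mapping.single i 1) 1"

definition monom_degree :: "(nat \<Rightarrow>\<^sub>0 nat) \<Rightarrow> nat" where
  "monom_degree m = (\<Sum>i\<in>Poly_Mapping.keys m. Poly_Mapping.lookup m i)"

definition homogeneous :: "nat \<Rightarrow> ('k::field) mpoly \<Rightarrow> bool" where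
  "homogeneous d f \<longleftrightarrow> (\<forall>m\<in>Poly_Mapping.keys f. monom_degree m = d)"

text \<open>The zero polynomial has degree 0 here, so \<open>0 < total_degree f\<close> forces \<open>f \<noteq> 0\<close>.\<close>

definition total_degree :: "('k::field) mpoly \<Rightarrow> nat" where
  "total_degree f = Max (insert 0 (monom_degree ` Poly_Mapping.keys f))"

lemma mpoly_ring_cring: "cring (mpoly_ring n :: ('k::field) mpoly ring)"
proof (rule cringI)
  let ?S = "mpoly_ring n :: 'k mpoly ring"
  show "abelian_group ?S"
  proof (rule abelian_groupI)
    fix x y assume "x \<in> carrier ?S" "y \<in> carrier ?S"
    then show "x \<oplus>\<^bsub>?S\<^esub> y \<in> carrier ?S"
      using Poly_Mapping.keys_add[of x y] by (auto simp: mpoly_ring_def)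
  next
    fix x assume "x \<in> carrier ?S"
    then show "\<exists>y\<in>carrier ?S. y \<oplus>\<^bsub>?S\<^esub> x = \<zero>\<^bsub>?S\<^esub>"
      by (intro bexI[of _ "- x"]) (auto simp: mpoly_ring_def)
  qed (auto simp: mpoly_ring_def algebra_simps)
  show "comm_monoid ?S"
  proof (rule comm_monoidI)
    fix x y assume x: "x \<in> carrier ?S" and y: "y \<in> carrier ?S"
    have "Poly_Mapping.keys m \<subseteq> {1..n}" if "m \<in> Poly_Mapping.keys (x * y)" for m
    proof -
      obtain a b where ab: "m = a + b" "a \<in> Poly_Mapping.keys x" "b \<in> Poly_Mapping.keys y"
        using \<open>m \<in> Poly_Mapping.keys (x * y)\<close> keys_mult[of x y] by blast
      have "Poly_Mapping.keys a \<subseteq> {1..n}" "Poly_Mapping.keys b \<subseteq> {1..n}"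
        using x y ab by (auto simp: mpoly_ring_def)
      then show ?thesis using Poly_Mapping.keys_add[of a b] ab(1) by blast
    qed
    then show "x \<otimes>\<^bsub>?S\<^esub> y \<in> carrier ?S" by (simp add: mpoly_ring_def)
  qed (auto simp: mpoly_ring_def algebra_simps)
qed (auto simp: mpoly_ring_def algebra_simps)


subsection \<open>Edge ideals and linear quotients\<close>

definition edge_ideal :: "nat \<Rightarrow> nat set set \<Rightarrow> ('k::field) mpoly set" where
  "edge_ideal n E = Idl\<^bsub>mpoly_ring n\<^esub> {var i * var j | i j. {i, j} \<in> E}"

definition colon_ideal :: "('a, 'b) ring_scheme \<Rightarrow> 'a set \<Rightarrow> 'a \<Rightarrow> 'a set" where
  "colon_ideal R I f = {g \<in> carrier R. g \<otimes>\<^bsub>R\<^esub> f \<in> I}"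

definition generated_by_linear_forms :: "nat \<Rightarrow> ('k::field) mpoly set \<Rightarrow> bool" where
  "generated_by_linear_forms n I \<longleftrightarrow>
     (\<exists>L. L \<subseteq> carrier (mpoly_ring n) \<and> (\<forall>l\<in>L. homogeneous 1 l) \<and> I = Idl\<^bsub>mpoly_ring n\<^esub> L)"

text \<open>
  Lists are indexed from 0, so index \<open>j\<close> below stands for the element \<open>f\<^sub>j\<^sub>+\<^sub>1\<close>. The empty
  sequence is allowed; it generates the zero ideal, which is the edge ideal of an edgeless graph.
\<close>

definition linear_quotients_seq :: "nat \<Rightarrow> ('k::field) mpoly list \<Rightarrow> bool" where
  "linear_quotients_seq n fs \<longleftrightarrow>
     set fs \<subseteq> carrier (mpoly_ring n) \<and>
     (\<forall>f\<in>set fs. (\<exists>d. homogeneous d f) \<and> 0 < total_degree f) \<and>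
     sorted (map total_degree fs) \<and>
     (\<forall>j. 1 \<le> j \<and> j < length fs \<longrightarrow>
        generated_by_linear_forms n
          (colon_ideal (mpoly_ring n) (Idl\<^bsub>mpoly_ring n\<^esub> (set (take j fs))) (fs ! j)))"

definition has_linear_quotients :: "nat \<Rightarrow> ('k::field) mpoly set \<Rightarrow> bool" where
  "has_linear_quotients n I \<longleftrightarrow>
     (\<exists>fs. linear_quotients_seq n fs \<and> I = Idl\<^bsub>mpoly_ring n\<^esub> (set fs))"

end

(*
  Label the vertices along a perfect elimination order of the complement, so that edges {a < b} and
  {c < d} of G with a < c force ac or ad to be an edge. Order the edges lexicographically and the
  k-fold products of edges by the multiset order on their least factorizations. If A < B are least
  factorizations of u and v, discard common edges and let pq be the largest edge, which lies in B.
  Walks alternating between A and B, started at a variable x_a with deg_a u > deg_a v, either lead to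
  a factorization of v x_a / x_b that trades a copy of pq for smaller edges, or they exhaust a
  part of A and B whose complement yields a smaller factorization of v itself. The latter is
  impossible, so x_a v lies in the ideal of the generators preceding v while x_a divides u / gcd(u, v).
*)
theory Submission
  imports Defs "HOL-Library.Multiset_Order" "HOL-Library.Product_Lexorder"
begin

section \<open>Perfect elimination orders of chordal graphs\<close>

text \<open>A surplus variable need not be joined to p or q, so a single edge of B cannot always
  absorb it. The walk moves the surplus to another vertex at the price of trading edges of B for
  edges of A. Two properties of the multiset order pay for this: it is compatible with adding common
  edges, and one lost copy of pq outweighs any number of new smaller edges. As every edge of A lies
  below pq, the walk may use an edge of A more often than A contains it. Edges of B must not be
  overspent and pq must be kept for the final trade, so each edge of B is spent at most once and a
  walk turns only at vertices below p. These are also the vertices to which the exchange property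
  applies against pq.\<close>

definition walk :: "nat set set \<Rightarrow> nat set \<Rightarrow> nat \<Rightarrow> nat \<Rightarrow> nat list \<Rightarrow> bool" where
  "walk H U x y Q \<longleftrightarrow> Q \<noteq> [] \<and> hd Q = x \<and> last Q = y \<and> set Q \<subseteq> U \<and> successively (\<lambda>a b. {a, b} \<in> H) Q"

text \<open>Cutting out the closed stretch between two visits to the same vertex would shorten the
  walk.\<close>

lemma shortest_walk_distinct:
  assumes Q: "walk H U x y Q" and least: "\<And>Q'. walk H U x y Q' \<Longrightarrow> length Q \<le> length Q'"
  shows "distinct Q"
proof (rule ccontr)
  assume "\<not> distinct Q"
  then obtain i j where ij: "i < j" "j < length Q" "Q ! i = Q ! j"
    by (metis distinct_conv_nth linorder_neqE_nat)
  let ?Q = "take i Q @ drop j Q"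
  have "hd ?Q = x"
    using Q ij by (cases "i = 0") (auto simp: walk_def hd_drop_conv_nth hd_append hd_conv_nth)
  moreover have "last ?Q = y" using Q ij by (auto simp: walk_def)
  moreover have "set ?Q \<subseteq> U"
    using Q by (auto simp: walk_def dest: in_set_takeD in_set_dropD)
  moreover have "successively (\<lambda>a b. {a, b} \<in> H) ?Q"
  proof -
    have s: "successively (\<lambda>a b. {a, b} \<in> H) Q" using Q by (simp add: walk_def)
    have "successively (\<lambda>a b. {a, b} \<in> H) (take i Q)" "successively (\<lambda>a b. {a, b} \<in> H) (drop j Q)"
      using s by (metis append_take_drop_id successively_append_iff)+
    moreover have "{last (take i Q), hd (drop j Q)} \<in> H" if "i \<noteq> 0"
    proof -
      have "last (take i Q) = Q ! (i - 1)" using that ij by (subst last_conv_nth) (auto simp: min_def)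
      then show ?thesis
        using successively_nth[OF s, of "i - 1"] that ij by (simp add: hd_drop_conv_nth)
    qed
    ultimately show ?thesis by (auto simp: successively_append_iff)
  qed
  ultimately have "walk H U x y ?Q" using ij by (simp add: walk_def)
  from least[OF this] show False using ij by simp
qed

text \<open>An edge between nonconsecutive positions would be a shortcut, so a shortest walk is an
  induced path.\<close>

lemma shortest_walk_induced:
  assumes Q: "walk H U x y Q" and least: "\<And>Q'. walk H U x y Q' \<Longrightarrow> length Q \<le> length Q'"
    and ij: "i < j" "j < length Q" "{Q ! i, Q ! j} \<in> H"
  shows "j = Suc i"
proof (rule ccontr)
  assume ne: "j \<noteq> Suc i"
  let ?Q = "take (Suc i) Q @ drop j Q"
  have "hd ?Q = x" using Q ij by (auto simp: walk_def hd_append)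
  moreover have "last ?Q = y" using Q ij by (auto simp: walk_def)
  moreover have "set ?Q \<subseteq> U"
    using Q by (auto simp: walk_def dest: in_set_takeD in_set_dropD)
  moreover have "successively (\<lambda>a b. {a, b} \<in> H) ?Q"
  proof -
    have s: "successively (\<lambda>a b. {a, b} \<in> H) Q" using Q by (simp add: walk_def)
    have "successively (\<lambda>a b. {a, b} \<in> H) (take (Suc i) Q)"
      "successively (\<lambda>a b. {a, b} \<in> H) (drop j Q)"
      using s by (metis append_take_drop_id successively_append_iff)+
    moreover have "{last (take (Suc i) Q), hd (drop j Q)} \<in> H"
      using ij by (simp add: hd_drop_conv_nth take_Suc_conv_app_nth)
    ultimately show ?thesis by (auto simp: successively_append_iff)
  qed
  ultimately have "walk H U x y ?Q" using ij by (simp add: walk_def)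
  from least[OF this] show False using ij ne by simp
qed

lemma rtrancl_imp_walk:
  assumes "(a, b) \<in> {(w, w'). w \<in> U \<and> w' \<in> U \<and> {w, w'} \<in> H}\<^sup>*" and "a \<in> U"
  shows "\<exists>Q. walk H U a b Q"
  using assms(1)
proof (induction rule: rtrancl_induct)
  case base
  show ?case using assms(2) by (intro exI[of _ "[a]"]) (simp add: walk_def)
next
  case (step b c)
  then obtain Q where "walk H U a b Q" by blast
  then have "walk H U a c (Q @ [c])"
    using step.hyps by (auto simp: walk_def successively_append_iff)
  then show ?case by blast
qed

lemma cycle_edgesI: "i < length c \<Longrightarrow> {c ! i, c ! (Suc i mod length c)} \<in> cycle_edges c"
  by (auto simp: cycle_edges_def)

text \<open>The shortest walk from \<open>x\<close> to \<open>y\<close> whose interior avoids the neighbourhood of \<open>v\<close> closes up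
  through \<open>v\<close> to a chordless cycle.\<close>

lemma chordal_neighbours_adjacent:
  assumes chordal: "chordal H" and two: "\<forall>e\<in>H. card e = 2"
    and W: "v \<notin> W" "\<And>w. w \<in> W \<Longrightarrow> {v, w} \<notin> H"
    and xy: "x \<noteq> y" "{v, x} \<in> H" "{v, y} \<in> H" and Q0: "walk H (W \<union> {x, y}) x y Q0"
  shows "{x, y} \<in> H"
proof (rule ccontr)
  assume nxy: "{x, y} \<notin> H"
  obtain Q where Q: "walk H (W \<union> {x, y}) x y Q"
    and least: "\<And>Q'. walk H (W \<union> {x, y}) x y Q' \<Longrightarrow> length Q \<le> length Q'"
    using ex_has_least_nat[of "walk H (W \<union> {x, y}) x y" Q0 length] Q0 by blast
  have s: "successively (\<lambda>a b. {a, b} \<in> H) Q" and ne: "Q \<noteq> []" using Q by (auto simp: walk_def)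
  have vne: "v \<noteq> x" "v \<noteq> y" using xy two by force+
  have vQ: "v \<notin> set Q" using Q W(1) vne by (auto simp: walk_def)
  have Q_0: "Q ! 0 = x" and Q_last: "Q ! (length Q - 1) = y"
    using Q by (auto simp: walk_def hd_conv_nth last_conv_nth)
  have "length Q \<noteq> 1" using Q_0 Q_last xy(1) by auto
  moreover have "length Q \<noteq> 2" using successively_nth[OF s, of 0] Q_0 Q_last nxy by auto
  \<comment> \<open>With \<open>v\<close> added the cycle has at least four vertices, the least
    length at which \<open>chordal\<close> demands a chord.\<close>
  ultimately have len: "3 \<le> length Q" using ne by (cases "length Q") auto
  let ?c = "v # Q"
  have edge_mem: "{Q ! i, Q ! Suc i} \<in> cycle_edges ?c" if "Suc i < length Q" for i
  proof -
    have "Suc (Suc i) mod length ?c = Suc (Suc i)" using that by (intro mod_less) simp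
    then show ?thesis
      using cycle_edgesI[of "Suc i" ?c] that by (simp only: nth_Cons_Suc length_Cons)
  qed
  have m0: "Suc 0 mod length ?c = Suc 0" using ne by (intro mod_less) auto
  have "{?c ! 0, ?c ! (Suc 0 mod length ?c)} \<in> cycle_edges ?c" by (rule cycle_edgesI) simp
  then have first: "{v, x} \<in> cycle_edges ?c" unfolding m0 nth_Cons_0 nth_Cons_Suc Q_0 .
  have cl: "?c ! length Q = y" using ne Q_last by (cases Q rule: rev_cases) auto
  have ml: "Suc (length Q) mod length ?c = 0" by simp
  have "{?c ! length Q, ?c ! (Suc (length Q) mod length ?c)} \<in> cycle_edges ?c"
    by (rule cycle_edgesI) simp
  then have "{y, v} \<in> cycle_edges ?c" unfolding cl ml nth_Cons_0 .
  then have last: "{v, y} \<in> cycle_edges ?c" by (simp only: insert_commute)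
  have "{?c ! i, ?c ! (Suc i mod length ?c)} \<in> H" if "i < length ?c" for i
  proof (cases i)
    case 0
    then show ?thesis using xy(2) by (simp only: m0 nth_Cons_0 nth_Cons_Suc Q_0)
  next
    case (Suc k)
    show ?thesis
    proof (cases "Suc k = length Q")
      case True
      then show ?thesis using Suc xy(3) by (simp only: cl ml nth_Cons_0 insert_commute)
    next
      case False
      then have "Suc i mod length ?c = Suc (Suc k)" using Suc that by (intro trans[OF mod_less]) auto
      then show ?thesis
        using successively_nth[OF s, of k] Suc that False by (simp only: nth_Cons_Suc length_Cons)
    qed
  qed
  then have "cycle_edges ?c \<subseteq> H" by (auto simp only: cycle_edges_def)
  moreover have "distinct ?c" using shortest_walk_distinct[OF Q least] vQ by simp
  moreover have "3 \<le> length ?c" "4 \<le> length ?c" using len by auto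
  ultimately have "is_cycle H ?c \<and> 4 \<le> length ?c" by (simp only: is_cycle_def)
  then obtain e where e: "e \<in> H" "e \<subseteq> set ?c" "e \<notin> cycle_edges ?c"
    using chordal unfolding chordal_def is_chord_def by blast
  then obtain a b where ab: "e = {a, b}" "a \<noteq> b" using two card_2_iff by metis
  \<comment> \<open>A chord at \<open>v\<close> would end in \<open>W\<close>, which contains no
    neighbour of \<open>v\<close>, or at \<open>x\<close> or \<open>y\<close>, which are next to
    \<open>v\<close> on the cycle.\<close>
  have via_v: False if "e = {v, b}" "b \<in> set Q" for b
  proof -
    have "b \<in> W \<union> {x, y}" using Q that(2) by (auto simp: walk_def)
    then show False using W(2) e(1,3) that(1) first last by auto
  qed
  show False
  proof (cases "a = v \<or> b = v")
    case True
    then show False using via_v ab e(2) by (auto simp: insert_commute)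
  next
    case False
    then obtain i j where "i < length Q" "Q ! i = a" "j < length Q" "Q ! j = b"
      using ab e(2) by (auto simp: in_set_conv_nth)
    then obtain i j where ij: "i < j" "j < length Q" "e = {Q ! i, Q ! j}"
      using ab by (metis insert_commute linorder_neqE_nat)
    then have "j = Suc i" using shortest_walk_induced[OF Q least] e(1) by blast
    then show False using edge_mem ij e(3) by blast
  qed
qed

section \<open>Dirac's theorem on simplicial vertices\<close>

definition simplicial :: "nat set set \<Rightarrow> nat set \<Rightarrow> nat \<Rightarrow> bool" where
  "simplicial H V z \<longleftrightarrow>
    (\<forall>x\<in>V. \<forall>y\<in>V. x \<noteq> y \<longrightarrow> {z, x} \<in> H \<longrightarrow> {z, y} \<in> H \<longrightarrow> {x, y} \<in> H)"

text \<open>Asking for a simplicial vertex away from \<open>v\<close> is what makes the induction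
  run: inside \<open>C \<union> S\<close> it must return a vertex of the component \<open>C\<close>
  and not of its boundary \<open>S\<close>, since only for vertices of \<open>C\<close> is it known
  that all neighbours stay in \<open>C \<union> S\<close>.\<close>

lemma exists_simplicial_nonneighbour:
  assumes chordal: "chordal H" and two: "\<forall>e\<in>H. card e = 2"
    and "finite V" "v \<in> V" "u \<in> V" "u \<noteq> v" "{v, u} \<notin> H"
  shows "\<exists>z\<in>V. z \<noteq> v \<and> {v, z} \<notin> H \<and> simplicial H V z"
  using assms(3-)
proof (induction V arbitrary: v u rule: finite_psubset_induct)
  case (psubset V)
  define W where "W = {w \<in> V. w \<noteq> v \<and> {v, w} \<notin> H}"
  define R where "R = {(w, w'). w \<in> W \<and> w' \<in> W \<and> {w, w'} \<in> H}"
  \<comment> \<open>\<open>C\<close> is the component of \<open>u\<close> among the vertices not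
    adjacent to \<open>v\<close>, and \<open>S\<close> is its boundary, which separates it from
    \<open>v\<close>.\<close>
  define C where "C = {w. (u, w) \<in> R\<^sup>*}"
  define S where "S = {s \<in> V - C. \<exists>c\<in>C. {s, c} \<in> H}"
  have uW: "u \<in> W" using psubset.prems by (auto simp: W_def)
  have "w \<in> W" if "(u, w) \<in> R\<^sup>*" for w
    using that uW by (induction rule: rtrancl_induct) (auto simp: R_def)
  then have CW: "C \<subseteq> W" by (auto simp: C_def)
  have symR: "sym (R\<^sup>*)" by (intro sym_rtrancl) (auto simp: sym_def R_def insert_commute)
  have closed: "x \<in> C \<or> x \<in> S" if "c \<in> C" "x \<in> V" "{c, x} \<in> H" for c x
    using that by (auto simp: S_def insert_commute)
  have Sv: "{v, s} \<in> H" if s: "s \<in> S" for s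
  proof (rule ccontr)
    assume "{v, s} \<notin> H"
    obtain c where c: "c \<in> C" "{s, c} \<in> H" "s \<in> V" "s \<notin> C" using s unfolding S_def by blast
    then have "s \<noteq> v" using CW by (auto simp: W_def)
    then have "s \<in> W" using c(3) \<open>{v, s} \<notin> H\<close> by (simp add: W_def)
    moreover have "c \<in> W" "{c, s} \<in> H" using c(1,2) CW by (auto simp: insert_commute)
    ultimately have "(c, s) \<in> R" by (simp add: R_def)
    then show False using c(1,4) by (auto simp: C_def intro: rtrancl_into_rtrancl)
  qed
  \<comment> \<open>Two boundary vertices are neighbours of \<open>v\<close> joined by a walk with
    interior in \<open>W\<close>, which contains no neighbour of \<open>v\<close>.\<close>
  have clique: "{x, y} \<in> H" if xy: "x \<in> S" "y \<in> S" "x \<noteq> y" for x y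
  proof -
    obtain c d where cd: "c \<in> C" "d \<in> C" "{x, c} \<in> H" "{y, d} \<in> H"
      using xy(1,2) unfolding S_def by blast
    have "(c, d) \<in> R\<^sup>*"
      using cd(1,2) symR unfolding C_def by (metis mem_Collect_eq rtrancl_trans symE)
    then obtain P where "walk H W c d P"
      using rtrancl_imp_walk[of c d W H] cd(1) CW unfolding R_def by auto
    then have "walk H (W \<union> {x, y}) x y (x # P @ [y])"
      using cd(3) cd(4)[unfolded insert_commute[of y d]]
      by (auto simp: walk_def successively_append_iff successively_Cons)
    moreover have "v \<notin> W" "\<And>w. w \<in> W \<Longrightarrow> {v, w} \<notin> H" by (auto simp: W_def)
    ultimately show ?thesis
      using chordal_neighbours_adjacent[OF chordal two] xy(3) Sv[OF xy(1)] Sv[OF xy(2)] by metis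
  qed
  have "v \<notin> C \<union> S" using CW by (auto simp: S_def W_def)
  moreover have "C \<union> S \<subseteq> V" using CW by (auto simp: S_def W_def)
  ultimately have sub: "C \<union> S \<subset> V" using psubset.prems by auto
  \<comment> \<open>The induction hypothesis is applied at a vertex \<open>s\<close> of
    \<open>S\<close>, or else \<open>c\<close> of \<open>C\<close>, that has a non-neighbour. In the
    first case the clique \<open>S\<close> forces \<open>z\<close> into \<open>C\<close>; in the
    second \<open>S\<close> is adjacent to everything. If neither exists,
    \<open>C \<union> S\<close> is complete and \<open>u\<close> serves.\<close>
  have "\<exists>z\<in>C. simplicial H (C \<union> S) z"
  proof (cases "\<exists>s\<in>S. \<exists>t\<in>C \<union> S. t \<noteq> s \<and> {s, t} \<notin> H")
    case True
    then obtain s t where st: "s \<in> S" "t \<in> C \<union> S" "t \<noteq> s" "{s, t} \<notin> H" by blast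
    then obtain z where "z \<in> C \<union> S" "z \<noteq> s" "{s, z} \<notin> H" "simplicial H (C \<union> S) z"
      using psubset.IH[OF sub, of s t] by blast
    then show ?thesis using clique[of s z] st(1) by blast
  next
    case univ: False
    show ?thesis
    proof (cases "\<exists>c\<in>C. \<exists>d\<in>C. d \<noteq> c \<and> {c, d} \<notin> H")
      case True
      then obtain c d where cd: "c \<in> C" "d \<in> C" "d \<noteq> c" "{c, d} \<notin> H" by blast
      then obtain z where z: "z \<in> C \<union> S" "z \<noteq> c" "{c, z} \<notin> H" "simplicial H (C \<union> S) z"
        using psubset.IH[OF sub, of c d] by blast
      then have "z \<notin> S" using univ cd(1) by (metis UnI1 insert_commute)
      then show ?thesis using z by blast
    next
      case False
      then have "simplicial H (C \<union> S) u"
        using univ unfolding simplicial_def by (metis UnE UnI1 insert_commute)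
      then show ?thesis by (auto simp: C_def)
    qed
  qed
  then obtain z where z: "z \<in> C" "simplicial H (C \<union> S) z" by blast
  then have "simplicial H V z" unfolding simplicial_def using closed by blast
  then show ?case using z(1) CW by (auto simp: W_def)
qed

lemma exists_simplicial:
  assumes "chordal H" "\<forall>e\<in>H. card e = 2" "finite V" "V \<noteq> {}"
  shows "\<exists>z\<in>V. simplicial H V z"
proof (cases "\<exists>v\<in>V. \<exists>u\<in>V. u \<noteq> v \<and> {v, u} \<notin> H")
  case True
  then show ?thesis using exists_simplicial_nonneighbour[OF assms(1-3)] by blast
next
  case False
  then have "\<forall>z\<in>V. simplicial H V z" unfolding simplicial_def by metis
  then show ?thesis using assms(4) by blast
qed

section \<open>Elimination orders by successive removal of simplicial vertices\<close>

definition perfect_elimination_order :: "nat set set \<Rightarrow> nat list \<Rightarrow> bool" where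
  "perfect_elimination_order H vs \<longleftrightarrow> distinct vs \<and>
    (\<forall>i j k. i < j \<and> i < k \<and> j \<noteq> k \<and> j < length vs \<and> k < length vs \<and>
      {vs ! i, vs ! j} \<in> H \<and> {vs ! i, vs ! k} \<in> H \<longrightarrow> {vs ! j, vs ! k} \<in> H)"

lemma perfect_elimination_order_Cons:
  assumes vs: "perfect_elimination_order H vs" and z: "z \<notin> set vs" "simplicial H (set vs) z"
  shows "perfect_elimination_order H (z # vs)"
  unfolding perfect_elimination_order_def
proof (intro conjI allI impI)
  show "distinct (z # vs)" using vs z(1) by (simp add: perfect_elimination_order_def)
next
  fix i j k
  assume ijk: "i < j \<and> i < k \<and> j \<noteq> k \<and> j < length (z # vs) \<and> k < length (z # vs) \<and>
    {(z # vs) ! i, (z # vs) ! j} \<in> H \<and> {(z # vs) ! i, (z # vs) ! k} \<in> H"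
  then obtain j' k' where jk: "j = Suc j'" "k = Suc k'" by (metis not0_implies_Suc not_less0)
  show "{(z # vs) ! j, (z # vs) ! k} \<in> H"
  proof (cases i)
    case 0
    have "vs ! j' \<in> set vs" "vs ! k' \<in> set vs" "vs ! j' \<noteq> vs ! k'"
      using vs ijk jk by (auto simp: perfect_elimination_order_def nth_eq_iff_index_eq)
    then show ?thesis using z(2) ijk 0 jk by (simp add: simplicial_def)
  next
    case (Suc i')
    then have "i' < j' \<and> i' < k' \<and> j' \<noteq> k' \<and> j' < length vs \<and> k' < length vs \<and>
      {vs ! i', vs ! j'} \<in> H \<and> {vs ! i', vs ! k'} \<in> H"
      using ijk jk by simp
    then have "{vs ! j', vs ! k'} \<in> H"
      using vs unfolding perfect_elimination_order_def by blast
    then show ?thesis using jk by simp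
  qed
qed

lemma exists_perfect_elimination_order:
  assumes "chordal H" "\<forall>e\<in>H. card e = 2" "finite V"
  shows "\<exists>vs. set vs = V \<and> perfect_elimination_order H vs"
  using assms(3)
proof (induction V rule: finite_psubset_induct)
  case (psubset V)
  show ?case
  proof (cases "V = {}")
    case True
    then show ?thesis by (auto simp: perfect_elimination_order_def)
  next
    case False
    then obtain z where z: "z \<in> V" "simplicial H V z"
      using exists_simplicial[OF assms(1,2) psubset.hyps] by blast
    then have "V - {z} \<subset> V" by blast
    from psubset.IH[OF this] obtain vs
      where vs: "set vs = V - {z}" "perfect_elimination_order H vs" by blast
    have "simplicial H (set vs) z" using z(2) vs(1) by (simp add: simplicial_def)
    then have "perfect_elimination_order H (z # vs)"
      using perfect_elimination_order_Cons vs by simp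
    then show ?thesis using vs(1) z(1) by (intro exI[of _ "z # vs"]) auto
  qed
qed


section \<open>Exchanging edges between factorizations\<close>

text \<open>This is the exponent vector of a product of edges: \<open>count (ends M) x\<close> is a
  degree, and \<open>ends M = ends N\<close> says that \<open>M\<close> and \<open>N\<close> factor
  the same monomial.\<close>

definition ends :: "('a \<times> 'a) multiset \<Rightarrow> 'a multiset" where
  "ends M = image_mset fst M + image_mset snd M"

lemma ends_empty [simp]: "ends {#} = {#}"
  by (simp add: ends_def)

lemma ends_add [simp]: "ends (M + N) = ends M + ends N"
  by (simp add: ends_def)

lemma ends_add_mset [simp]: "ends (add_mset f M) = {#fst f, snd f#} + ends M"
  by (simp add: ends_def)

lemma size_ends: "size (ends M) = 2 * size M"
  by (simp add: ends_def)

lemma in_ends_iff: "x \<in># ends M \<longleftrightarrow> (\<exists>y. (x, y) \<in># M \<or> (y, x) \<in># M)"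
  by (force simp: ends_def)

text \<open>Edges are stored with the smaller end first; this names the edge joining
  \<open>c\<close> and \<open>d\<close> when it is not known which of them is smaller.\<close>

definition ordered_pair :: "'a::linorder \<Rightarrow> 'a \<Rightarrow> 'a \<times> 'a" where
  "ordered_pair c d = (min c d, max c d)"

lemma ends_ordered_pair: "{#fst (ordered_pair c d), snd (ordered_pair c d)#} = {#c, d#}"
  by (auto simp: ordered_pair_def min_def max_def add_mset_commute)

lemma ordered_pair_eq_iff:
  "ordered_pair c d = ordered_pair c' d' \<longleftrightarrow> (c = c' \<and> d = d') \<or> (c = d' \<and> d = c')"
  by (auto simp: ordered_pair_def min_def max_def split: if_splits)

text \<open>\<open>exchange\<close> is the contrapositive of the elimination property of the
  complement: were \<open>a\<close> joined there to both later vertices \<open>c\<close> and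
  \<open>d\<close>, then \<open>{c, d}\<close> would be an edge of the complement too.\<close>

locale exchange_graph =
  fixes E :: "('a::linorder \<times> 'a) set"
  assumes edge_less: "(a, b) \<in> E \<Longrightarrow> a < b"
    and exchange: "(a, b) \<in> E \<Longrightarrow> (c, d) \<in> E \<Longrightarrow> a < c \<Longrightarrow> (a, c) \<in> E \<or> (a, d) \<in> E"

text \<open>A supposed counterexample to the swap statement: disjoint \<open>A\<close> and
  \<open>B\<close>, \<open>(p, q)\<close> the largest edge occurring, \<open>B\<close> least for its
  monomial, and no admissible swap. The locale ends with a proof of \<open>False\<close>.\<close>

locale irreducible_pair = exchange_graph E for E :: "('a::linorder \<times> 'a) set" +
  fixes A B :: "('a \<times> 'a) multiset" and p q :: 'a
  assumes A_edges: "set_mset A \<subseteq> E" and B_edges: "set_mset B \<subseteq> E"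
    and disjoint: "A \<inter># B = {#}" and same_size: "size A = size B"
    and pq_in_B: "(p, q) \<in># B"
    and A_less: "f \<in># A \<Longrightarrow> f < (p, q)" and B_le: "f \<in># B \<Longrightarrow> f \<le> (p, q)"
    and no_refactor: "set_mset B' \<subseteq> E \<Longrightarrow> B' < B \<Longrightarrow> ends B' \<noteq> ends B"
    and no_swap: "count (ends B) a < count (ends A) a \<Longrightarrow> set_mset B' \<subseteq> E \<Longrightarrow> B' < B \<Longrightarrow>
      add_mset a (ends B) \<noteq> add_mset b (ends B')"
begin

text \<open>A surplus variable \<open>a\<close> is pushed along an alternating walk: an edge \<open>(c, t)\<close> of \<open>A\<close> absorbs
  the current token \<open>t\<close>, and the edge of \<open>B\<close> at \<open>c\<close> that it replaces releases the new token \<open>d\<close>.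
  The set \<open>F\<close> records the edges of \<open>B\<close> spent so far. As soon as a token can be joined to \<open>p\<close> or
  \<open>q\<close> by an edge below \<open>(p, q)\<close>, a copy of \<open>(p, q)\<close> is traded for smaller edges, contradicting
  \<open>no_swap\<close>.\<close>

inductive reach :: "('a \<times> 'a) set \<Rightarrow> 'a \<Rightarrow> bool" where
  start: "count (ends B) a < count (ends A) a \<Longrightarrow> reach {} a"
| step: "reach F t \<Longrightarrow> (c, t) \<in># A \<Longrightarrow> c < p \<Longrightarrow> ordered_pair c d \<in># B \<Longrightarrow>
    ordered_pair c d \<notin> F \<Longrightarrow> reach (insert (ordered_pair c d) F) d"

lemma reach_edges:
  assumes "reach F t"
  shows "finite F" "F \<subseteq> set_mset B" "\<forall>f\<in>F. fst f < p"
  using assms by (induction rule: reach.induct) (auto simp: ordered_pair_def min_less_iff_disj)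

text \<open>The trades telescope: a step adds \<open>ordered_pair c d\<close> on the left and
  \<open>(c, t)\<close> on the right, which turns the token \<open>t\<close> into \<open>d\<close>.
  Multiplicities in \<open>M\<close> are left free, because later only the position of its edges
  below \<open>(p, q)\<close> matters.\<close>

lemma reach_exchange:
  assumes "reach F t"
  shows "\<exists>a M. count (ends B) a < count (ends A) a \<and> set_mset M \<subseteq> set_mset A \<and>
    add_mset a (ends (mset_set F)) = add_mset t (ends M)"
  using assms
proof (induction rule: reach.induct)
  case (start a)
  then show ?case by (intro exI[of _ a] exI[of _ "{#}"]) simp
next
  case (step F t c d)
  then obtain a M where IH: "count (ends B) a < count (ends A) a" "set_mset M \<subseteq> set_mset A"
    "add_mset a (ends (mset_set F)) = add_mset t (ends M)" by blast
  have "finite F" using step.hyps(1) reach_edges by blast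
  then have "ends (mset_set (insert (ordered_pair c d) F)) = {#c, d#} + ends (mset_set F)"
    using mset_set.insert[OF _ step.hyps(5)] ends_ordered_pair[of c d] by simp
  then have "add_mset a (ends (mset_set (insert (ordered_pair c d) F)))
      = {#c, d#} + add_mset a (ends (mset_set F))" by simp
  also have "\<dots> = add_mset d (ends (add_mset (c, t) M))"
    unfolding IH(3) by simp
  finally show ?case using IH(1,2) step.hyps(2)
    by (intro exI[of _ a] exI[of _ "add_mset (c, t) M"]) auto
qed

text \<open>The trade recorded by the walk is composed with a last trade of the unspent edges
  \<open>N\<close> for \<open>M'\<close>. Together they swap the original surplus \<open>a\<close>
  for \<open>b\<close>; the removed part contains \<open>(p, q)\<close>, which dominates everything
  added, so \<open>B' < B\<close>.\<close>

lemma no_win: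
  assumes "reach F t" and N: "N \<subseteq># B - mset_set F" "(p, q) \<in># N"
    and M': "set_mset M' \<subseteq> E" "\<forall>m\<in>#M'. m < (p, q)"
    and eq: "add_mset t (ends N) = add_mset b (ends M')"
  shows False
proof -
  obtain a M where a: "count (ends B) a < count (ends A) a" and M: "set_mset M \<subseteq> set_mset A"
    and aM: "add_mset a (ends (mset_set F)) = add_mset t (ends M)"
    using reach_exchange[OF assms(1)] by blast
  have F: "mset_set F \<subseteq># B"
    using reach_edges[OF assms(1)]
    by (metis finite_set_mset_mset_set mset_set_set_mset_msubset subset_imp_msubset_mset_set
        subset_mset.order_trans finite_set_mset)
  then obtain R where R: "B = mset_set F + N + R"
    using N(1) by (metis subset_mset.add_diff_inverse union_assoc)
  define B' where "B' = R + (M + M')"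
  have "B' < B"
    unfolding less_multiset\<^sub>D\<^sub>M
  proof (intro exI conjI)
    show "mset_set F + N \<noteq> {#}" using N(2) by auto
    show "mset_set F + N \<subseteq># B" using R by simp
    show "B' = B - (mset_set F + N) + (M + M')" by (simp add: R B'_def)
    show "\<forall>k. k \<in># M + M' \<longrightarrow> (\<exists>a. a \<in># mset_set F + N \<and> k < a)"
      using N(2) M'(2) M A_less by (metis in_mono union_iff)
  qed
  moreover have "set_mset B' \<subseteq> E"
    using M M'(1) A_edges B_edges R by (auto simp: B'_def)
  moreover have "add_mset a (ends B) = add_mset b (ends B')"
  proof -
    have "add_mset a (ends B) = add_mset a (ends (mset_set F)) + ends N + ends R"
      by (simp add: R)
    also have "\<dots> = add_mset t (ends N) + ends M + ends R"
      unfolding aM by simp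
    also have "\<dots> = add_mset b (ends B')"
      unfolding eq by (simp add: B'_def)
    finally show ?thesis .
  qed
  ultimately show False using no_swap[OF a] by blast
qed

lemma pq_edge: "(p, q) \<in> E" "p < q"
  using pq_in_B B_edges edge_less by auto

text \<open>Spent edges have their first vertex below \<open>p\<close>, so \<open>(p, q)\<close> is
  never spent.\<close>

lemma pq_available: "reach F t \<Longrightarrow> {#(p, q)#} \<subseteq># B - mset_set F"
  using reach_edges(3) pq_in_B
  by (metis fst_conv finite_set_mset_mset_set in_diff_count mset_set.infinite count_mset_set(3)
      count_greater_zero_iff mset_subset_eq_single order_less_irrefl)

text \<open>The pair \<open>(p, q)\<close> would be traded for the edge at \<open>t\<close>, and its
  other end released as \<open>b\<close>; \<open>t < p\<close> makes the new edge smaller.\<close>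

lemma token_not_joined_low:
  assumes "reach F t" "t < p" "(t, p) \<in> E \<or> (t, q) \<in> E"
  shows False
proof -
  from assms(3) show False
  proof
    assume "(t, p) \<in> E"
    then show False using no_win[OF assms(1) pq_available[OF assms(1)], of "{#(t, p)#}" q] assms(2)
      by (auto simp: add_mset_commute)
  next
    assume "(t, q) \<in> E"
    then show False using no_win[OF assms(1) pq_available[OF assms(1)], of "{#(t, q)#}" p] assms(2)
      by (auto simp: add_mset_commute)
  qed
qed

lemma token_not_joined_middle:
  assumes "reach F t" "t < q" "(p, t) \<in> E"
  shows False
  using no_win[OF assms(1) pq_available[OF assms(1)], of "{#(p, t)#}" q] assms(2,3)
  by (auto simp: add_mset_commute)

text \<open>\<open>T\<close> collects the tokens of all walks together, \<open>C\<close> the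
  vertices at which some walk may turn.\<close>

definition T :: "'a set" where "T = {t. \<exists>F. reach F t}"
definition C :: "'a set" where "C = {c. c < p \<and> (\<exists>t\<in>T. (c, t) \<in># A)}"

lemma reach_path:
  assumes "reach F t" "f \<in> F"
  shows "\<exists>c\<in>C. \<exists>d\<in>T. f = ordered_pair c d"
  using assms
proof (induction rule: reach.induct)
  case (step F t c d)
  from step.hyps have "d \<in> T" "c \<in> C"
    using reach.step[OF step.hyps(1-5)] by (auto simp: T_def C_def)
  then show ?case using step by blast
qed simp

lemma surplus_in_T: "count (ends B) a < count (ends A) a \<Longrightarrow> a \<in> T"
  using start by (auto simp: T_def)

text \<open>For \<open>t < p\<close> the exchange property against \<open>(p, q)\<close> joins the
  token to \<open>p\<close> or \<open>q\<close>. The delicate case is \<open>t = p\<close>: then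
  \<open>c\<close> is not a surplus vertex, so it lies on an edge \<open>(d, c)\<close> of
  \<open>B\<close>. This edge is still unspent, and \<open>(p, q)\<close> and \<open>(d, c)\<close>
  are traded at once.\<close>

lemma token_no_up_edge:
  assumes t: "t \<in> T" and tc: "(t, c) \<in># A"
  shows False
proof -
  obtain F where F: "reach F t" using t by (auto simp: T_def)
  have tcE: "(t, c) \<in> E" using tc A_edges by blast
  have less: "(t, c) < (p, q)" using tc A_less by blast
  have "t < c" using tcE by (rule edge_less)
  show False
  proof (cases "t < p")
    case True
    then show False using token_not_joined_low[OF F] exchange[OF tcE pq_edge(1)] by blast
  next
    case False
    then have tp: "t = p" "c < q" using less by (auto simp: order_le_less)
    have c_notin: "c \<notin> T"
      using token_not_joined_middle tp tcE by (auto simp: T_def)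
    then have "count (ends A) c \<le> count (ends B) c"
      using surplus_in_T leI by blast
    moreover have "c \<in># ends A" using tc by (auto simp: in_ends_iff)
    ultimately have "c \<in># ends B" by (metis count_greater_zero_iff order_less_le_trans)
    then obtain d where "(c, d) \<in># B \<or> (d, c) \<in># B" by (auto simp: in_ends_iff)
    moreover have "(c, d) \<notin># B" using B_le[of "(c, d)"] \<open>t < c\<close> tp by auto
    ultimately have dc: "(d, c) \<in># B" by blast
    have "d \<noteq> p" using dc tc tp disjoint by (metis disjunct_not_in)
    moreover have "d \<le> p" using B_le[OF dc] by auto
    ultimately have "d < p" by simp
    have dcE: "(d, c) \<in> E" using dc B_edges by auto
    \<comment> \<open>Spent edges have one end in \<open>C\<close> and the other in
      \<open>T\<close>, while \<open>c\<close> is no token and lies above \<open>p\<close>.\<close>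
    have "(d, c) \<notin> F"
    proof
      assume "(d, c) \<in> F"
      then obtain c' d' where "c' \<in> C" "d' \<in> T" "(d, c) = ordered_pair c' d'"
        using reach_path[OF F] by blast
      then have "c \<in> C \<or> c \<in> T"
        by (auto simp: ordered_pair_def min_def max_def split: if_splits)
      then show False using c_notin \<open>t < c\<close> tp by (auto simp: C_def)
    qed
    then have N: "{#(p, q), (d, c)#} \<subseteq># B - mset_set F"
      using pq_available[OF F] dc \<open>d < p\<close> reach_edges(1)[OF F]
      by (auto simp: insert_subset_eq_iff in_diff_count count_mset_set(3))
    from exchange[OF dcE pq_edge(1) \<open>d < p\<close>] show False
    proof
      assume "(d, p) \<in> E"
      then show False
        using no_win[OF F N, of "{#(p, c), (d, p)#}" q] tcE tp \<open>d < p\<close>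
        by (auto simp: add_mset_commute)
    next
      assume "(d, q) \<in> E"
      then show False
        using no_win[OF F N, of "{#(p, c), (d, q)#}" p] tcE tp \<open>d < p\<close>
        by (auto simp: add_mset_commute)
    qed
  qed
qed

lemma token_down_edge:
  assumes t: "t \<in> T" and ct: "(c, t) \<in># A"
  shows "c \<in> C"
proof -
  obtain F where F: "reach F t" using t by (auto simp: T_def)
  have "(c, t) < (p, q)" using ct A_less by blast
  moreover have "\<not> (c = p \<and> t < q)"
    using token_not_joined_middle[OF F] ct A_edges by auto
  ultimately have "c < p" by auto
  then show ?thesis using t ct by (auto simp: C_def)
qed

lemma T_C_disjoint: "T \<inter> C = {}"
  using token_no_up_edge by (auto simp: C_def)

text \<open>If the edge is unspent, the walk that reached \<open>t\<close> can take it. If it is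
  spent, it joins \<open>C\<close> to \<open>T\<close>, and by disjointness \<open>c\<close> is its
  end in \<open>C\<close>.\<close>

lemma C_edge_B:
  assumes c: "c \<in> C" and cd: "ordered_pair c d \<in># B"
  shows "d \<in> T"
proof -
  obtain t F where tF: "(c, t) \<in># A" "c < p" "reach F t" using c by (auto simp: C_def T_def)
  show ?thesis
  proof (cases "ordered_pair c d \<in> F")
    case True
    then obtain c' d' where "c' \<in> C" "d' \<in> T" "ordered_pair c d = ordered_pair c' d'"
      using reach_path[OF tF(3)] by blast
    then show ?thesis using T_C_disjoint c by (auto simp: ordered_pair_eq_iff)
  next
    case False
    then show ?thesis using reach.step[OF tF(3,1,2) cd] by (auto simp: T_def)
  qed
qed

text \<open>Degree counting shows that no edge of \<open>A\<close> or \<open>B\<close> joins \<open>T \<union> C\<close> to the remaining vertices and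
  that \<open>A\<close> and \<open>B\<close> have equal degrees there. Trading the edges of \<open>B\<close> off \<open>T \<union> C\<close>, among them
  \<open>(p, q)\<close>, for those of \<open>A\<close> refactors the same monomial into smaller edges.\<close>

lemma impossible: False
proof -
  let ?n = "\<lambda>S M. size (filter_mset (\<lambda>x. x \<in> S) (ends M))"
  define A2 where "A2 = filter_mset (\<lambda>f. snd f \<in> T) A"
  define A1 where "A1 = filter_mset (\<lambda>f. snd f \<notin> T) A"
  define B2 where "B2 = filter_mset (\<lambda>f. fst f \<in> C \<or> snd f \<in> C) B"
  define B1 where "B1 = filter_mset (\<lambda>f. \<not> (fst f \<in> C \<or> snd f \<in> C)) B"
  have A: "A = A1 + A2" and B: "B = B1 + B2"
    by (simp_all add: A1_def A2_def B1_def B2_def)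
  have endsA: "ends A = ends A1 + ends A2" using ends_add[of A1 A2] A by simp
  have endsB: "ends B = ends B1 + ends B2" using ends_add[of B1 B2] B by simp
  have cnt: "?n S M = size (filter_mset (\<lambda>f. fst f \<in> S) M) + size (filter_mset (\<lambda>f. snd f \<in> S) M)"
    for S M
    by (simp add: ends_def filter_mset_image_mset comp_def)
  have A2: "fst f \<in> C" "snd f \<in> T" "fst f \<notin> T" "snd f \<notin> C" if "f \<in># A2" for f
    using that token_down_edge[of "snd f" "fst f"] T_C_disjoint by (auto simp: A2_def)
  have A1: "fst f \<notin> T" "snd f \<notin> T" if "f \<in># A1" for f
    using that token_no_up_edge[of "fst f" "snd f"] by (auto simp: A1_def)
  have B2: "(fst f \<in> C \<and> snd f \<in> T \<and> fst f \<notin> T \<and> snd f \<notin> C) \<or>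
      (fst f \<in> T \<and> snd f \<in> C \<and> fst f \<notin> C \<and> snd f \<notin> T)" if "f \<in># B2" for f
  proof -
    have f: "f \<in># B" "fst f \<in> C \<or> snd f \<in> C" using that by (auto simp: B2_def)
    then have "fst f < snd f" using B_edges edge_less[of "fst f" "snd f"] by auto
    then have "ordered_pair (fst f) (snd f) = f" "ordered_pair (snd f) (fst f) = f"
      by (auto simp: ordered_pair_def)
    then show ?thesis using f C_edge_B[of "fst f" "snd f"] C_edge_B[of "snd f" "fst f"] T_C_disjoint
      by auto
  qed
  have TA: "?n T A = size A2"
  proof -
    have "filter_mset (\<lambda>f. fst f \<in> T) A = {#}"
      using token_no_up_edge by auto
    then show ?thesis by (simp add: cnt A2_def)
  qed
  have CA2: "?n C A2 = size A2"
  proof -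
    have "filter_mset (\<lambda>f. fst f \<in> C) A2 = A2" "filter_mset (\<lambda>f. snd f \<in> C) A2 = {#}"
      using A2 by (auto simp: filter_mset_eq_conv)
    then show ?thesis by (simp add: cnt)
  qed
  have B2split: "?n S B2 = size B2"
    if S: "S = C \<or> S = T" for S
  proof -
    have "filter_mset (\<lambda>f. snd f \<in> S) B2 = filter_mset (\<lambda>f. fst f \<notin> S) B2"
      using B2 S by (intro filter_mset_cong) auto
    then show ?thesis by (simp add: cnt flip: size_union)
  qed
  have CB1: "?n C B1 = 0"
    by (simp add: cnt B1_def)
  have CA: "?n C A = ?n C A1 + size A2" by (simp add: endsA CA2)
  have CB: "?n C B = size B2" using B2split[of C] CB1 by (simp add: endsB)
  have TB: "?n T B = ?n T B1 + size B2" using B2split[of T] by (simp add: endsB)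
  have sub: "filter_mset (\<lambda>x. x \<in> S) (ends A) \<subseteq># filter_mset (\<lambda>x. x \<in> S) (ends B)"
    if "S \<inter> T = {}" for S
    using that surplus_in_T by (auto simp: subseteq_mset_def)
  have tot: "?n T M + ?n (- T) M = 2 * size M" for M
    by (simp add: size_ends[symmetric] flip: size_union)
  have le1: "?n C A \<le> ?n C B"
    using sub[of C] T_C_disjoint by (intro size_mset_mono) auto
  have sub2: "filter_mset (\<lambda>x. x \<in> - T) (ends A) \<subseteq># filter_mset (\<lambda>x. x \<in> - T) (ends B)"
    by (intro sub) auto
  then have le2: "?n (- T) A \<le> ?n (- T) B" by (rule size_mset_mono)
  \<comment> \<open>Equality is forced along \<open>size A2 \<le> ?n C A \<le> ?n C B = size B2
    \<le> ?n T B \<le> ?n T A = size A2\<close>; here \<open>?n T B \<le> ?n T A\<close> is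
    \<open>le2\<close> read through the equal total degrees.\<close>
  have eqs: "?n C A1 = 0" "?n T B1 = 0" "?n (- T) A = ?n (- T) B"
    using le1 le2 CA CB TB TA tot[of A] tot[of B] same_size by linarith+
  have "filter_mset (\<lambda>x. x \<in> - T) (ends A) = filter_mset (\<lambda>x. x \<in> - T) (ends B)"
    using sub2 eqs(3) by (metis mset_subset_size nat_neq_iff subset_mset.le_imp_less_or_eq)
  then have "filter_mset (\<lambda>x. x \<notin> C) (filter_mset (\<lambda>x. x \<in> - T) (ends A)) =
      filter_mset (\<lambda>x. x \<notin> C) (filter_mset (\<lambda>x. x \<in> - T) (ends B))" by simp
  then have eq: "filter_mset (\<lambda>x. x \<notin> T \<and> x \<notin> C) (ends A) = filter_mset (\<lambda>x. x \<notin> T \<and> x \<notin> C) (ends B)"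
    by (simp add: filter_filter_mset conj_commute)
  have "x \<notin> T" if "x \<in># ends A1" for x using that A1 by (force simp: in_ends_iff)
  moreover have "x \<notin> C" if "x \<in># ends A1" for x
    using that eqs(1) by auto
  moreover have "x \<in> T \<or> x \<in> C" if "x \<in># ends A2" for x using that A2 by (force simp: in_ends_iff)
  ultimately have "filter_mset (\<lambda>x. x \<notin> T \<and> x \<notin> C) (ends A1) = ends A1"
    and "filter_mset (\<lambda>x. x \<notin> T \<and> x \<notin> C) (ends A2) = {#}"
    by (auto simp: filter_mset_eq_conv)
  then have fA: "filter_mset (\<lambda>x. x \<notin> T \<and> x \<notin> C) (ends A) = ends A1"
    by (simp only: endsA filter_union_mset add_0_right)
  have "x \<notin> T" if "x \<in># ends B1" for x
    using that eqs(2) by auto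
  moreover have "x \<notin> C" if "x \<in># ends B1" for x
    using that by (auto simp: in_ends_iff B1_def)
  moreover have "x \<in> T \<or> x \<in> C" if "x \<in># ends B2" for x using that B2 by (force simp: in_ends_iff)
  ultimately have "filter_mset (\<lambda>x. x \<notin> T \<and> x \<notin> C) (ends B1) = ends B1"
    and "filter_mset (\<lambda>x. x \<notin> T \<and> x \<notin> C) (ends B2) = {#}"
    by (auto simp: filter_mset_eq_conv)
  then have fB: "filter_mset (\<lambda>x. x \<notin> T \<and> x \<notin> C) (ends B) = ends B1"
    by (simp only: endsB filter_union_mset add_0_right)
  have ends1: "ends A1 = ends B1" using eq fA fB by simp
  \<comment> \<open>Neither \<open>p\<close> nor \<open>q\<close> is in \<open>C\<close>, whose
    members all lie below \<open>p\<close>.\<close>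
  have pq1: "(p, q) \<in># B1"
    using pq_in_B pq_edge(2) by (auto simp: B1_def C_def)
  have "A1 + B2 < B"
    unfolding less_multiset\<^sub>D\<^sub>M
  proof (intro exI conjI)
    show "B1 \<noteq> {#}" using pq1 by auto
    show "B1 \<subseteq># B" by (subst B) simp
    show "A1 + B2 = B - B1 + A1" by (subst B) simp
    show "\<forall>k. k \<in># A1 \<longrightarrow> (\<exists>a. a \<in># B1 \<and> k < a)"
      using pq1 A_less unfolding A1_def set_mset_filter mem_Collect_eq by meson
  qed
  moreover have "set_mset (A1 + B2) \<subseteq> E" using A_edges B_edges by (auto simp: A1_def B2_def)
  ultimately show False using no_refactor[of "A1 + B2"] ends1 endsB by simp
qed

end

section \<open>Swaps between two factorizations\<close>

context exchange_graph
begin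

lemma exists_swap_disjoint:
  assumes A: "set_mset A \<subseteq> E" and B: "set_mset B \<subseteq> E" and size: "size A = size B"
    and disj: "A \<inter># B = {#}" and less: "A < B"
    and min: "\<And>B'. set_mset B' \<subseteq> E \<Longrightarrow> ends B' = ends B \<Longrightarrow> \<not> B' < B"
  shows "\<exists>a b B'. count (ends B) a < count (ends A) a \<and> set_mset B' \<subseteq> E \<and> B' < B \<and>
    add_mset a (ends B) = add_mset b (ends B')"
proof (rule ccontr)
  assume contra: "\<not> ?thesis"
  have ne: "set_mset (A + B) \<noteq> {}" using less by auto
  define e where "e = Max (set_mset (A + B))"
  have e: "e \<in># A + B" "\<And>f. f \<in># A + B \<Longrightarrow> f \<le> e"
    unfolding e_def using Max_in[OF _ ne] by auto
  \<comment> \<open>As \<open>A < B\<close>, an excess of \<open>A\<close> at the largest edge would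
    have to be compensated by a still larger edge of \<open>B\<close>.\<close>
  have "e \<notin># A"
  proof
    assume "e \<in># A"
    then have "count B e < count A e" using disj
      by (metis count_greater_zero_iff disjunct_not_in not_in_iff)
    then obtain x where "x > e" "count A x < count B x"
      using less unfolding less_multiset\<^sub>H\<^sub>O by blast
    then show False using e(2)[of x] by (metis count_inI leD not_less0 union_iff)
  qed
  then have eB: "e \<in># B" using e(1) by simp
  obtain p q where pq: "e = (p, q)" by (cases e)
  interpret irreducible_pair E A B p q
  proof unfold_locales
    show "f < (p, q)" if "f \<in># A" for f
      using that e(2)[of f] \<open>e \<notin># A\<close> pq by (auto simp: order_le_less)
    show "f \<le> (p, q)" if "f \<in># B" for f
      using that e(2)[of f] pq by auto
  qed (use A B size disj eB pq min contra in blast)+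
  show False by (rule impossible)
qed

theorem exists_swap:
  assumes A: "set_mset A \<subseteq> E" and B: "set_mset B \<subseteq> E" and size: "size A = size B"
    and less: "A < B"
    and min: "\<And>B'. set_mset B' \<subseteq> E \<Longrightarrow> ends B' = ends B \<Longrightarrow> \<not> B' < B"
  shows "\<exists>a b B'. count (ends B) a < count (ends A) a \<and> set_mset B' \<subseteq> E \<and> B' < B \<and>
    add_mset a (ends B) = add_mset b (ends B')"
proof -
  define D A0 B0 where "D = A \<inter># B" and "A0 = A - D" and "B0 = B - D"
  have A': "A = A0 + D" and B': "B = B0 + D"
    by (auto simp: A0_def B0_def D_def multiset_eq_iff min_def)
  have "A0 \<inter># B0 = {#}"
    by (rule multiset_eqI) (simp add: A0_def B0_def D_def)
  then have "\<exists>a b B'. count (ends B0) a < count (ends A0) a \<and> set_mset B' \<subseteq> E \<and> B' < B0 \<and>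
    add_mset a (ends B0) = add_mset b (ends B')"
  proof (rule exists_swap_disjoint[rotated 3])
    show "\<not> M < B0" if "set_mset M \<subseteq> E" "ends M = ends B0" for M
      using min[of "M + D"] that B by (auto simp: B')
  qed (use A B size less in \<open>auto simp: A' B'\<close>)
  then obtain a b B'' where "count (ends B0) a < count (ends A0) a" "set_mset B'' \<subseteq> E" "B'' < B0"
    "add_mset a (ends B0) = add_mset b (ends B'')" by blast
  then show ?thesis using B
    by (intro exI[of _ a] exI[of _ b] exI[of _ "B'' + D"]) (auto simp: A' B' simp flip: union_mset_add_mset_left)
qed

end


section \<open>Monomial ideals\<close>

abbreviation monomial :: "(nat \<Rightarrow>\<^sub>0 nat) \<Rightarrow> ('k::field) mpoly" where
  "monomial m \<equiv> Poly_Mapping.single m 1"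

lemma mpoly_sum_singles:
  "f = (\<Sum>m\<in>Poly_Mapping.keys f. Poly_Mapping.single m (Poly_Mapping.lookup f m))"
  by (rule poly_mapping_eqI) (simp add: lookup_sum lookup_single when_def not_in_keys_iff_lookup_eq_zero)

lemma lookup_mult_monomial:
  fixes f :: "('k::field) mpoly"
  shows "Poly_Mapping.lookup (f * monomial v) (m + v) = Poly_Mapping.lookup f m"
proof -
  have "f * monomial v = (\<Sum>k\<in>Poly_Mapping.keys f. Poly_Mapping.single (k + v) (Poly_Mapping.lookup f k))"
    by (subst mpoly_sum_singles[of f]) (simp add: sum_distrib_right mult_single)
  then have "Poly_Mapping.lookup (f * monomial v) (m + v)
      = (\<Sum>k\<in>Poly_Mapping.keys f. Poly_Mapping.lookup f k when k = m)"
    by (simp add: lookup_sum lookup_single)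
  then show ?thesis by (simp add: when_def not_in_keys_iff_lookup_eq_zero)
qed

definition monomials :: "nat \<Rightarrow> (nat \<Rightarrow>\<^sub>0 nat) set" where
  "monomials n = {m. Poly_Mapping.keys m \<subseteq> {1..n}}"

lemma monomial_carrier: "monomial m \<in> carrier (mpoly_ring n) \<longleftrightarrow> m \<in> monomials n"
  by (simp add: mpoly_ring_def monomials_def)

lemma keys_add_nat:
  fixes a b :: "nat \<Rightarrow>\<^sub>0 nat"
  shows "Poly_Mapping.keys (a + b) = Poly_Mapping.keys a \<union> Poly_Mapping.keys b"
  by (auto simp: in_keys_iff lookup_add)

lemma monomials_add_iff: "a + b \<in> monomials n \<longleftrightarrow> a \<in> monomials n \<and> b \<in> monomials n"
  by (simp add: monomials_def keys_add_nat)

lemma zero_in_monomials: "0 \<in> monomials n"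
  by (simp add: monomials_def)

context
  fixes n :: nat and R :: "('k::field) mpoly ring"
  defines "R \<equiv> mpoly_ring n"
begin

lemma R_cring: "cring R" "ring R"
  using mpoly_ring_cring[of n, where 'k = 'k] by (auto simp: R_def cring.axioms)

lemma R_simps: "(\<otimes>\<^bsub>R\<^esub>) = (*)" "\<one>\<^bsub>R\<^esub> = 1" "\<zero>\<^bsub>R\<^esub> = 0" "(\<oplus>\<^bsub>R\<^esub>) = (+)"
  by (simp_all add: R_def mpoly_ring_def)

lemma monomial_ideal:
  "ideal {f \<in> carrier R. \<forall>m\<in>Poly_Mapping.keys f. \<exists>u\<in>M. \<exists>w. m = u + w} R" (is "ideal ?I R")
proof -
  interpret cring R by (rule R_cring)
  show ?thesis
  proof (rule idealI)
    show "ring R" by (rule R_cring)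
    show "subgroup ?I (add_monoid R)"
    proof (rule add.subgroupI)
      show "?I \<subseteq> carrier R" by auto
      have "0 \<in> ?I" using zero_closed by (simp add: R_simps)
      then show "?I \<noteq> {}" by blast
    next
      fix f assume f: "f \<in> ?I"
      have "\<ominus>\<^bsub>R\<^esub> f = - f"
        using f by (intro minus_equality) (auto simp: R_simps, auto simp: R_def mpoly_ring_def)
      then show "\<ominus>\<^bsub>R\<^esub> f \<in> ?I" using f by (auto simp: R_def mpoly_ring_def)
    next
      fix f g assume "f \<in> ?I" "g \<in> ?I"
      then show "f \<oplus>\<^bsub>R\<^esub> g \<in> ?I"
        using Poly_Mapping.keys_add[of f g] a_closed[of f g] by (auto simp: R_simps)
    qed
  next
    fix f g assume f: "f \<in> ?I" and g: "g \<in> carrier R"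
    have "\<exists>u\<in>M. \<exists>w. m = u + w" if m: "m \<in> Poly_Mapping.keys (g * f)" for m
    proof -
      obtain a b where ab: "m = a + b" "b \<in> Poly_Mapping.keys f" using m keys_mult[of g f] by blast
      then obtain u w where "u \<in> M" "b = u + w" using f by blast
      then show ?thesis using ab by (intro bexI[of _ u] exI[of _ "a + w"]) (auto simp: ac_simps)
    qed
    then show gf: "g \<otimes>\<^bsub>R\<^esub> f \<in> ?I" using f g m_closed[of g f] by (simp add: R_simps)
    have "f \<otimes>\<^bsub>R\<^esub> g = g \<otimes>\<^bsub>R\<^esub> f" by (simp add: R_simps mult.commute)
    then show "f \<otimes>\<^bsub>R\<^esub> g \<in> ?I" using gf by simp
  qed
qed

lemma monomial_subset_carrier: "M \<subseteq> monomials n \<Longrightarrow> monomial ` M \<subseteq> carrier R"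
  by (auto simp: R_def monomial_carrier)

text \<open>The right-hand side describes an ideal containing the generators. Conversely, every term
  of such an \<open>f\<close> is a multiple of a generator, and \<open>f\<close> is the sum of its
  terms.\<close>

lemma in_monomial_ideal_iff:
  assumes M: "M \<subseteq> monomials n"
  shows "f \<in> Idl\<^bsub>R\<^esub> (monomial ` M) \<longleftrightarrow>
    f \<in> carrier R \<and> (\<forall>m\<in>Poly_Mapping.keys f. \<exists>u\<in>M. \<exists>w. m = u + w)"
proof -
  interpret cring R by (rule R_cring)
  let ?I = "{f \<in> carrier R. \<forall>m\<in>Poly_Mapping.keys f. \<exists>u\<in>M. \<exists>w. m = u + w}"
  have "monomial ` M \<subseteq> ?I"
    using monomial_subset_carrier[OF M] by (force intro: exI[of _ 0])
  then have sub: "Idl\<^bsub>R\<^esub> (monomial ` M) \<subseteq> ?I" using monomial_ideal by (intro genideal_minimal)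
  interpret I: ideal "Idl\<^bsub>R\<^esub> (monomial ` M)" R
    using genideal_ideal monomial_subset_carrier[OF M] by blast
  have gen: "monomial u \<in> Idl\<^bsub>R\<^esub> (monomial ` M)" if "u \<in> M" for u
    using genideal_self[OF monomial_subset_carrier[OF M]] that by blast
  have "f \<in> Idl\<^bsub>R\<^esub> (monomial ` M)" if f: "f \<in> ?I" for f
  proof -
    have single_mem: "Poly_Mapping.single m (Poly_Mapping.lookup f m) \<in> Idl\<^bsub>R\<^esub> (monomial ` M)"
      if m: "m \<in> Poly_Mapping.keys f" for m
    proof -
      obtain u w where uw: "u \<in> M" "m = u + w" using f m by blast
      have "m \<in> monomials n" using f m by (auto simp: R_def mpoly_ring_def monomials_def)
      then have "Poly_Mapping.single w (Poly_Mapping.lookup f m) \<in> carrier R"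
        using uw(2) by (simp add: R_def mpoly_ring_def monomials_add_iff) (simp add: monomials_def)
      from I.I_l_closed[OF gen[OF uw(1)] this] show ?thesis
        by (simp add: R_simps mult_single uw(2) add.commute)
    qed
    have "(\<Sum>m\<in>K. Poly_Mapping.single m (Poly_Mapping.lookup f m)) \<in> Idl\<^bsub>R\<^esub> (monomial ` M)"
      if "finite K" "K \<subseteq> Poly_Mapping.keys f" for K
      using that
    proof (induction K rule: finite_induct)
      case empty
      then show ?case using I.zero_closed by (simp add: R_simps)
    next
      case (insert m K)
      then show ?case using I.a_closed single_mem by (simp add: R_simps)
    qed
    from this[of "Poly_Mapping.keys f"] show ?thesis using mpoly_sum_singles[of f] by simp
  qed
  then show ?thesis using sub by blast
qed

lemma ideal_prod_monomial:
  assumes M: "M \<subseteq> monomials n" and N: "N \<subseteq> monomials n"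
  shows "ideal_prod R (Idl\<^bsub>R\<^esub> (monomial ` M)) (Idl\<^bsub>R\<^esub> (monomial ` N)) =
    Idl\<^bsub>R\<^esub> (monomial ` {u + v | u v. u \<in> M \<and> v \<in> N})" (is "ideal_prod R ?I ?J = Idl\<^bsub>R\<^esub> (monomial ` ?P)")
proof
  interpret cring R by (rule R_cring)
  have P: "?P \<subseteq> monomials n" using M N by (auto simp: monomials_add_iff)
  note mem = in_monomial_ideal_iff
  interpret P: ideal "Idl\<^bsub>R\<^esub> (monomial ` ?P)" R
    using genideal_ideal monomial_subset_carrier[OF P] by blast
  show "ideal_prod R ?I ?J \<subseteq> Idl\<^bsub>R\<^esub> (monomial ` ?P)"
  proof
    fix f assume "f \<in> ideal_prod R ?I ?J"
    then show "f \<in> Idl\<^bsub>R\<^esub> (monomial ` ?P)"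
    proof (induction rule: ideal_prod.induct)
      case (prod i j)
      then have "i \<in> carrier R" "j \<in> carrier R" using mem M N by auto
      then have "i * j \<in> carrier R" using m_closed[of i j] by (simp add: R_simps)
      moreover have "\<exists>u\<in>?P. \<exists>w. m = u + w" if m: "m \<in> Poly_Mapping.keys (i * j)" for m
      proof -
        obtain a b where ab: "m = a + b" "a \<in> Poly_Mapping.keys i" "b \<in> Poly_Mapping.keys j"
          using m keys_mult[of i j] by blast
        obtain u w where u: "u \<in> M" "a = u + w" using prod(1) ab(2) mem[OF M] by blast
        obtain u' w' where u': "u' \<in> N" "b = u' + w'" using prod(2) ab(3) mem[OF N] by blast
        have "m = (u + u') + (w + w')" using ab u u' by (simp add: ac_simps)
        then show ?thesis using u u' by blast
      qed
      ultimately show ?case using mem[OF P] by (simp add: R_simps)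
    next
      case (sum s t)
      then show ?case by (intro P.a_closed)
    qed
  qed
  have IJ: "ideal ?I R" "ideal ?J R"
    using genideal_ideal monomial_subset_carrier M N by blast+
  have "monomial ` ?P \<subseteq> ideal_prod R ?I ?J"
  proof
    fix f :: "'k mpoly" assume "f \<in> monomial ` ?P"
    then obtain u v where uv: "u \<in> M" "v \<in> N" "f = monomial (u + v)" by blast
    have "monomial u \<otimes>\<^bsub>R\<^esub> monomial v \<in> ideal_prod R ?I ?J"
      using uv genideal_self[OF monomial_subset_carrier[OF M]] genideal_self[OF monomial_subset_carrier[OF N]]
      by (intro ideal_prod.prod) auto
    then show "f \<in> ideal_prod R ?I ?J" by (simp add: uv R_simps mult_single)
  qed
  then show "Idl\<^bsub>R\<^esub> (monomial ` ?P) \<subseteq> ideal_prod R ?I ?J"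
    using ideal_prod_is_ideal[OF IJ] by (intro genideal_minimal)
qed

text \<open>Indexing by multisets over \<open>X\<close> keeps the factorizations visible, which the
  ordering of the generators relies on.\<close>

lemma monomial_ideal_power:
  assumes g: "g ` X \<subseteq> monomials n"
  shows "(Idl\<^bsub>R\<^esub> (monomial ` g ` X)) [^]\<^bsub>ideals_set R\<^esub> (k::nat) =
    Idl\<^bsub>R\<^esub> (monomial ` {\<Sum>x\<in>#B. g x | B. set_mset B \<subseteq> X \<and> size B = k})"
proof (induction k)
  case 0
  interpret cring R by (rule R_cring)
  \<comment> \<open>The empty product is the monomial 1, in accordance with the zeroth power being
    the whole ring.\<close>
  have "{\<Sum>x\<in>#B. g x | B. set_mset B \<subseteq> X \<and> size B = 0} = {0}" by auto
  then have "Idl\<^bsub>R\<^esub> (monomial ` {\<Sum>x\<in>#B. g x | B. set_mset B \<subseteq> X \<and> size B = 0}) = carrier R"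
    using genideal_one by (simp add: R_simps)
  then show ?case by (simp add: ideals_set_def)
next
  case (Suc k)
  let ?M = "{\<Sum>x\<in>#B. g x | B. set_mset B \<subseteq> X \<and> size B = k}"
  have "(\<Sum>x\<in>#B. g x) \<in> monomials n" if "set_mset B \<subseteq> X" for B
    using that g by (induction B) (auto simp: monomials_add_iff zero_in_monomials)
  then have M: "?M \<subseteq> monomials n" by blast
  have "{u + v | u v. u \<in> ?M \<and> v \<in> g ` X} = {\<Sum>x\<in>#B. g x | B. set_mset B \<subseteq> X \<and> size B = Suc k}"
    (is "?L = ?R")
  proof
    show "?L \<subseteq> ?R"
    proof
      fix m assume "m \<in> ?L"
      then obtain B x where "set_mset B \<subseteq> X" "size B = k" "x \<in> X" "m = (\<Sum>x\<in>#B. g x) + g x" by blast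
      then show "m \<in> ?R" by (intro CollectI exI[of _ "add_mset x B"]) (auto simp: add.commute)
    qed
    show "?R \<subseteq> ?L"
    proof
      fix m assume "m \<in> ?R"
      then obtain B where B: "set_mset B \<subseteq> X" "size B = Suc k" "m = (\<Sum>x\<in>#B. g x)" by blast
      then obtain x B' where "B = add_mset x B'" by (meson size_eq_Suc_imp_eq_union)
      then show "m \<in> ?L"
        using B by (intro CollectI exI[of _ "\<Sum>x\<in>#B'. g x"] exI[of _ "g x"]) (auto simp: add.commute)
    qed
  qed
  then have "ideal_prod R (Idl\<^bsub>R\<^esub> (monomial ` ?M)) (Idl\<^bsub>R\<^esub> (monomial ` g ` X)) =
      Idl\<^bsub>R\<^esub> (monomial ` {\<Sum>x\<in>#B. g x | B. set_mset B \<subseteq> X \<and> size B = Suc k})"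
    using ideal_prod_monomial[OF M g] by simp
  moreover have "(Idl\<^bsub>R\<^esub> (monomial ` g ` X)) [^]\<^bsub>ideals_set R\<^esub> Suc k =
      ideal_prod R (Idl\<^bsub>R\<^esub> (monomial ` ?M)) (Idl\<^bsub>R\<^esub> (monomial ` g ` X))"
    using Suc by (simp add: ideals_set_def)
  ultimately show ?case by simp
qed

text \<open>If \<open>m + v\<close> is a multiple of \<open>u\<close>, then \<open>m\<close> has
  positive exponent wherever \<open>u\<close> exceeds \<open>v\<close>. By \<open>swap\<close> one
  such variable lies in the colon ideal itself, so the variables there generate it.\<close>

lemma colon_monomial_linear:
  assumes M: "M \<subseteq> monomials n" and v: "v \<in> monomials n"
    and swap: "\<And>u. u \<in> M \<Longrightarrow> \<exists>a. Poly_Mapping.lookup v a < Poly_Mapping.lookup u a \<and>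
      (\<exists>u'\<in>M. \<exists>w. v + Poly_Mapping.single a 1 = u' + w)"
  shows "generated_by_linear_forms n (colon_ideal R (Idl\<^bsub>R\<^esub> (monomial ` M)) (monomial v))"
proof -
  interpret cring R by (rule R_cring)
  define A where "A = {a \<in> {1..n}. \<exists>u\<in>M. \<exists>w. v + Poly_Mapping.single a 1 = u + w}"
  define N where "N = (\<lambda>a. Poly_Mapping.single a 1 :: nat \<Rightarrow>\<^sub>0 nat) ` A"
  have N: "N \<subseteq> monomials n" by (auto simp: N_def A_def monomials_def)
  have v': "monomial v \<in> carrier R" using v by (simp add: R_def monomial_carrier)
  have "colon_ideal R (Idl\<^bsub>R\<^esub> (monomial ` M)) (monomial v) = Idl\<^bsub>R\<^esub> (monomial ` N)"
  proof (intro Set.set_eqI iffI)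
    fix f assume "f \<in> colon_ideal R (Idl\<^bsub>R\<^esub> (monomial ` M)) (monomial v)"
    then have f: "f \<in> carrier R" "f * monomial v \<in> Idl\<^bsub>R\<^esub> (monomial ` M)"
      by (auto simp: colon_ideal_def R_simps)
    have "\<exists>u\<in>N. \<exists>w. m = u + w" if m: "m \<in> Poly_Mapping.keys f" for m
    proof -
      have "m + v \<in> Poly_Mapping.keys (f * monomial v)"
        using m by (simp add: in_keys_iff lookup_mult_monomial)
      then obtain u w where u: "u \<in> M" "m + v = u + w" using f(2) in_monomial_ideal_iff[OF M] by blast
      obtain a where a: "Poly_Mapping.lookup v a < Poly_Mapping.lookup u a"
        "\<exists>u'\<in>M. \<exists>w. v + Poly_Mapping.single a 1 = u' + w" using swap[OF u(1)] by blast
      have "a \<in> Poly_Mapping.keys u" using a(1) by (auto simp: in_keys_iff)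
      moreover have "u \<in> monomials n" using M u(1) by blast
      ultimately have "a \<in> A" using a(2) by (auto simp: A_def monomials_def)
      have "Poly_Mapping.lookup m a + Poly_Mapping.lookup v a = Poly_Mapping.lookup u a + Poly_Mapping.lookup w a"
        using arg_cong[OF u(2), of "\<lambda>p. Poly_Mapping.lookup p a"] by (simp add: lookup_add)
      then have "Poly_Mapping.lookup m a \<ge> 1" using a(1) by linarith
      then have "m = Poly_Mapping.single a 1 + (m - Poly_Mapping.single a 1)"
        by (intro poly_mapping_eqI) (auto simp: lookup_add lookup_minus lookup_single when_def)
      then show ?thesis using \<open>a \<in> A\<close> by (auto simp: N_def)
    qed
    then show "f \<in> Idl\<^bsub>R\<^esub> (monomial ` N)" using f(1) in_monomial_ideal_iff[OF N] by blast
  next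
    fix f assume "f \<in> Idl\<^bsub>R\<^esub> (monomial ` N)"
    then have f: "f \<in> carrier R" "\<forall>m\<in>Poly_Mapping.keys f. \<exists>u\<in>N. \<exists>w. m = u + w"
      using in_monomial_ideal_iff[OF N] by auto
    have "\<exists>u\<in>M. \<exists>w. m = u + w" if m: "m \<in> Poly_Mapping.keys (f * monomial v)" for m
    proof -
      obtain m' where m': "m = m' + v" "m' \<in> Poly_Mapping.keys f"
        using m keys_mult[of f "monomial v"] by auto
      then obtain a w where a: "a \<in> A" "m' = Poly_Mapping.single a 1 + w" using f(2) by (auto simp: N_def)
      then obtain u w' where u: "u \<in> M" "v + Poly_Mapping.single a 1 = u + w'" by (auto simp: A_def)
      have "m = (v + Poly_Mapping.single a 1) + w" using m' a by (simp add: ac_simps)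
      also have "\<dots> = u + (w' + w)" using u by (simp add: ac_simps)
      finally show ?thesis using u(1) by blast
    qed
    then show "f \<in> colon_ideal R (Idl\<^bsub>R\<^esub> (monomial ` M)) (monomial v)"
      using f(1) m_closed[OF f(1) v'] in_monomial_ideal_iff[OF M]
      by (auto simp: colon_ideal_def R_simps)
  qed
  moreover have "\<forall>l\<in>(monomial ` N :: 'k mpoly set). homogeneous 1 l"
    by (auto simp: N_def homogeneous_def monom_degree_def)
  ultimately show ?thesis
    using monomial_subset_carrier[OF N] unfolding generated_by_linear_forms_def R_def by blast
qed

end


section \<open>Powers of the edge ideal\<close>

definition vertex_monomial :: "nat list \<Rightarrow> nat multiset \<Rightarrow> (nat \<Rightarrow>\<^sub>0 nat)" where
  "vertex_monomial vs U = (\<Sum>i\<in>#U. Poly_Mapping.single (vs ! i) 1)"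

lemma vertex_monomial_simps [simp]:
  "vertex_monomial vs {#} = 0"
  "vertex_monomial vs (add_mset i U) = Poly_Mapping.single (vs ! i) 1 + vertex_monomial vs U"
  "vertex_monomial vs (U + V) = vertex_monomial vs U + vertex_monomial vs V"
  by (simp_all add: vertex_monomial_def)

lemma lookup_vertex_monomial:
  assumes "distinct vs" "set_mset U \<subseteq> {..<length vs}" "i < length vs"
  shows "Poly_Mapping.lookup (vertex_monomial vs U) (vs ! i) = count U i"
  using assms(2)
  by (induction U) (use assms(1,3) in \<open>auto simp: lookup_add lookup_single when_def nth_eq_iff_index_eq\<close>)

lemma monom_degree_add: "monom_degree (a + b) = monom_degree a + monom_degree b"
  unfolding monom_degree_def using setsum_keys_plus_distrib[of "\<lambda>_ x. x" a b] by simp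

lemma monom_degree_vertex_monomial: "monom_degree (vertex_monomial vs U) = size U"
proof (induction U)
  case (add i U)
  have "monom_degree (Poly_Mapping.single (vs ! i) 1) = 1" by (simp add: monom_degree_def)
  then show ?case using add by (simp add: monom_degree_add)
qed (simp add: monom_degree_def)

lemma vertex_monomial_in_monomials:
  "set_mset U \<subseteq> {..<length vs} \<Longrightarrow> set vs = {1..n} \<Longrightarrow> vertex_monomial vs U \<in> monomials n"
proof (induction U)
  case (add i U)
  then have "vs ! i \<in> {1..n}" using nth_mem[of i vs] by auto
  then show ?case using add by (simp add: monomials_add_iff) (simp add: monomials_def)
qed (simp add: zero_in_monomials)

text \<open>The pairs hold positions in \<open>vs\<close> instead of vertices, so that the order on
  \<open>nat\<close> becomes the elimination order.\<close>

definition edge_pairs :: "nat set set \<Rightarrow> nat list \<Rightarrow> (nat \<times> nat) set" where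
  "edge_pairs E vs = {(i, j). i < j \<and> j < length vs \<and> {vs ! i, vs ! j} \<in> E}"

lemma edge_pairs_subset: "edge_pairs E vs \<subseteq> {..<length vs} \<times> {..<length vs}"
  by (auto simp: edge_pairs_def)

lemma ends_edge_pairs: "set_mset B \<subseteq> edge_pairs E vs \<Longrightarrow> set_mset (ends B) \<subseteq> {..<length vs}"
  using edge_pairs_subset[of E vs] by (auto simp: in_ends_iff) blast+

lemma edge_ideal_generators:
  assumes "simple_graph n E" and vs: "set vs = {1..n}"
  shows "{var i * var j | i j. {i, j} \<in> E} =
    (monomial ` (\<lambda>(i, j). vertex_monomial vs {#i, j#}) ` edge_pairs E vs :: ('k::field) mpoly set)"
    (is "?L = ?R")
proof
  have var_mult: "(var x * var y :: 'k mpoly) = monomial (Poly_Mapping.single x 1 + Poly_Mapping.single y 1)"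
    for x y by (simp add: var_def mult_single)
  show "?L \<subseteq> ?R"
  proof
    fix f :: "'k mpoly" assume "f \<in> ?L"
    then obtain x y where xy: "{x, y} \<in> E" "f = var x * var y" by blast
    then have "{x, y} \<subseteq> set vs" "card {x, y} = 2"
      using assms(1) vs unfolding simple_graph_def by blast+
    then have "x \<in> set vs" "y \<in> set vs" "x \<noteq> y" by auto
    then obtain i j where ij: "i < length vs" "j < length vs" "vs ! i = x" "vs ! j = y" "x \<noteq> y"
      unfolding in_set_conv_nth by blast
    then consider "i < j" | "j < i" by (metis linorder_neqE_nat)
    then show "f \<in> ?R"
    proof cases
      case 1
      then have "(i, j) \<in> edge_pairs E vs" using ij xy by (simp add: edge_pairs_def)
      then show ?thesis using ij xy by (force simp: var_mult)
    next
      case 2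
      then have "(j, i) \<in> edge_pairs E vs" using ij xy by (simp add: edge_pairs_def insert_commute)
      then show ?thesis using ij xy by (force simp: var_mult add.commute)
    qed
  qed
  show "?R \<subseteq> ?L"
  proof
    fix f :: "'k mpoly" assume "f \<in> ?R"
    then obtain i j where "(i, j) \<in> edge_pairs E vs" "f = var (vs ! i) * var (vs ! j)"
      by (auto simp: var_mult)
    then show "f \<in> ?L" by (auto simp: edge_pairs_def)
  qed
qed

lemma sum_edge_monomials:
  "(\<Sum>f\<in>#B. (\<lambda>(i, j). vertex_monomial vs {#i, j#}) f) = vertex_monomial vs (ends B)"
  by (induction B) (auto simp: add.assoc)

lemma exchange_graph_edge_pairs:
  assumes vs: "distinct vs" "set vs = {1..n}"
    and order: "perfect_elimination_order (complement_edges n E) vs"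
  shows "exchange_graph (edge_pairs E vs)"
proof
  show "a < b" if "(a, b) \<in> edge_pairs E vs" for a b using that by (simp add: edge_pairs_def)
  show "(a, c) \<in> edge_pairs E vs \<or> (a, d) \<in> edge_pairs E vs"
    if ab: "(a, b) \<in> edge_pairs E vs" and cd: "(c, d) \<in> edge_pairs E vs" and ac: "a < c" for a b c d
  proof (rule ccontr)
    have lt: "c < d" "d < length vs" "{vs ! c, vs ! d} \<in> E" using cd by (auto simp: edge_pairs_def)
    assume "\<not> ?thesis"
    then have nE: "{vs ! a, vs ! c} \<notin> E" "{vs ! a, vs ! d} \<notin> E"
      using lt ac by (auto simp: edge_pairs_def)
    have compl: "{vs ! a, vs ! x} \<in> complement_edges n E"
      if "x < length vs" "a < x" "{vs ! a, vs ! x} \<notin> E" for x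
    proof -
      have "vs ! a \<noteq> vs ! x" using that vs(1) by (simp add: nth_eq_iff_index_eq)
      moreover have "vs ! a \<in> {1..n}" "vs ! x \<in> {1..n}"
        using that vs(2) nth_mem[of a vs] nth_mem[of x vs] by auto
      ultimately show ?thesis using that(3) by (simp add: complement_edges_def)
    qed
    have "{vs ! a, vs ! c} \<in> complement_edges n E" "{vs ! a, vs ! d} \<in> complement_edges n E"
      using compl[of c] compl[of d] nE lt(1,2) ac by simp_all
    then have "a < c \<and> a < d \<and> c \<noteq> d \<and> c < length vs \<and> d < length vs \<and>
      {vs ! a, vs ! c} \<in> complement_edges n E \<and> {vs ! a, vs ! d} \<in> complement_edges n E"
      using lt ac by (intro conjI) simp_all
    then have "{vs ! c, vs ! d} \<in> complement_edges n E"
      using order unfolding perfect_elimination_order_def by blast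
    then show False using lt(3) by (simp add: complement_edges_def)
  qed
qed

lemma set_take_strict_sorted:
  fixes xs :: "'a::linorder list"
  assumes "sorted_wrt (<) xs" "j < length xs"
  shows "set (take j xs) = {x \<in> set xs. x < xs ! j}"
proof
  show "set (take j xs) \<subseteq> {x \<in> set xs. x < xs ! j}"
  proof
    fix x assume "x \<in> set (take j xs)"
    then obtain i where "i < j" "x = xs ! i" using assms(2) by (auto simp: in_set_conv_nth)
    then show "x \<in> {x \<in> set xs. x < xs ! j}" using assms by (simp add: sorted_wrt_iff_nth_less)
  qed
  show "{x \<in> set xs. x < xs ! j} \<subseteq> set (take j xs)"
  proof
    fix x assume "x \<in> {x \<in> set xs. x < xs ! j}"
    then obtain i where i: "i < length xs" "x = xs ! i" "xs ! i < xs ! j" by (auto simp: in_set_conv_nth)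
    then have "i < j" using assms by (metis linorder_neqE_nat less_asym less_irrefl sorted_wrt_iff_nth_less)
    then show "x \<in> set (take j xs)" using i assms(2) by (auto simp: in_set_conv_nth)
  qed
qed

text \<open>Two members with the same \<open>ends\<close> are each at most the other, hence equal;
  so each monomial occurs once among the generators.\<close>

definition least_factorizations :: "(nat \<times> nat) set \<Rightarrow> nat \<Rightarrow> (nat \<times> nat) multiset set" where
  "least_factorizations P k = {B. set_mset B \<subseteq> P \<and> size B = k \<and>
    (\<forall>B'. set_mset B' \<subseteq> P \<longrightarrow> ends B' = ends B \<longrightarrow> B \<le> B')}"

lemma exists_least_factorization:
  assumes "finite P" "set_mset B \<subseteq> P" "size B = k"
  shows "\<exists>B0\<in>least_factorizations P k. ends B0 = ends B \<and> B0 \<le> B"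
proof -
  let ?S = "{B'. set_mset B' \<subseteq> P \<and> ends B' = ends B}"
  \<comment> \<open>All factorizations of a monomial have equally many edges, so there are finitely
    many and a minimum exists.\<close>
  have same: "size B' = k" if "ends B' = ends B" for B' :: "(nat \<times> nat) multiset"
    using arg_cong[OF that, of size] assms(3) by (simp add: size_ends)
  then have "?S \<subseteq> multisets_of_size P k" unfolding multisets_of_size_def by blast
  then have fin: "finite ?S" using finite_multisets_of_size[OF assms(1)] finite_subset by blast
  have B: "B \<in> ?S" using assms(2) by simp
  have "Min ?S \<in> ?S" using fin B by (intro Min_in) auto
  moreover have "Min ?S \<le> B'" if "B' \<in> ?S" for B' using fin that by (rule Min_le)
  ultimately show ?thesis using same B
    by (intro bexI[of _ "Min ?S"]) (auto simp: least_factorizations_def)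
qed

theorem corollary3p2:
  fixes n k :: nat and E :: "nat set set"
  assumes "simple_graph n E"
    and "chordal (complement_edges n E)"
    and "k \<ge> 1"
  shows "has_linear_quotients n
           ((edge_ideal n E :: ('k::field) mpoly set) [^]\<^bsub>ideals_set (mpoly_ring n)\<^esub> k)"
proof -
  have "\<forall>e\<in>complement_edges n E. card e = 2" by (simp add: complement_edges_def)
  from exists_perfect_elimination_order[OF assms(2) this, of "{1..n}"]
  obtain vs where vs: "set vs = {1..n}" and order: "perfect_elimination_order (complement_edges n E) vs"
    by auto
  have dist: "distinct vs" using order by (simp add: perfect_elimination_order_def)
  define P where "P = edge_pairs E vs"
  interpret exchange_graph P
    unfolding P_def using exchange_graph_edge_pairs[OF dist vs order] .
  have finP: "finite P"
    unfolding P_def using edge_pairs_subset finite_subset by blast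
  define e where "e = (\<lambda>B. vertex_monomial vs (ends B))"
  have e_monomials: "e B \<in> monomials n" if "set_mset B \<subseteq> P" for B
    unfolding e_def using that vertex_monomial_in_monomials ends_edge_pairs vs P_def by blast
  define \<B> where "\<B> = least_factorizations P k"
  have \<B>: "set_mset B \<subseteq> P" "size B = k" if "B \<in> \<B>" for B
    using that by (auto simp: \<B>_def least_factorizations_def)
  have fin\<B>: "finite \<B>"
    using finite_multisets_of_size[OF finP, of k]
    by (rule rev_finite_subset) (use \<B> in \<open>auto simp: multisets_of_size_def\<close>)
  define l where "l = sorted_list_of_set \<B>"
  define fs where "fs = map (\<lambda>B. monomial (e B) :: 'k mpoly) l"
  have set_l: "set l = \<B>" and sorted_l: "sorted_wrt (<) l"
    using fin\<B> by (simp_all add: l_def)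
  let ?g = "\<lambda>(i, j). vertex_monomial vs {#i, j#}"
  have g: "?g ` P \<subseteq> monomials n"
  proof
    fix m assume "m \<in> ?g ` P"
    then obtain i j where "(i, j) \<in> P" "m = vertex_monomial vs {#i, j#}" by auto
    then show "m \<in> monomials n" using e_monomials[of "{#(i, j)#}"] by (simp add: e_def)
  qed
  have I: "(edge_ideal n E :: 'k mpoly set) = Idl\<^bsub>mpoly_ring n\<^esub> (monomial ` ?g ` P)"
    unfolding edge_ideal_def P_def edge_ideal_generators[OF assms(1) vs] by (rule refl)
  have e_sum: "e B = (\<Sum>f\<in>#B. ?g f)" for B
    unfolding e_def sum_edge_monomials by (rule refl)
  have "(edge_ideal n E :: 'k mpoly set) [^]\<^bsub>ideals_set (mpoly_ring n)\<^esub> k =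
      Idl\<^bsub>mpoly_ring n\<^esub> (monomial ` {e B | B. set_mset B \<subseteq> P \<and> size B = k})"
    unfolding I e_sum by (rule monomial_ideal_power[OF g])
  also have "{e B | B. set_mset B \<subseteq> P \<and> size B = k} = e ` \<B>"
  proof
    show "{e B | B. set_mset B \<subseteq> P \<and> size B = k} \<subseteq> e ` \<B>"
    proof
      fix m assume "m \<in> {e B | B. set_mset B \<subseteq> P \<and> size B = k}"
      then obtain B where B: "set_mset B \<subseteq> P" "size B = k" "m = e B" by blast
      from exists_least_factorization[OF finP B(1,2)]
      obtain B0 where "B0 \<in> \<B>" "ends B0 = ends B" unfolding \<B>_def by blast
      then have "m = e B0" using B(3) by (simp add: e_def)
      then show "m \<in> e ` \<B>" using \<open>B0 \<in> \<B>\<close> by (rule image_eqI)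
    qed
    show "e ` \<B> \<subseteq> {e B | B. set_mset B \<subseteq> P \<and> size B = k}"
    proof
      fix m assume "m \<in> e ` \<B>"
      then obtain B where "B \<in> \<B>" "m = e B" by (elim imageE)
      then show "m \<in> {e B | B. set_mset B \<subseteq> P \<and> size B = k}"
        using \<B>[of B] by (intro CollectI exI[of _ B] conjI)
    qed
  qed
  also have "monomial ` e ` \<B> = set fs" by (simp add: fs_def set_l image_image)
  finally have gens: "(edge_ideal n E :: 'k mpoly set) [^]\<^bsub>ideals_set (mpoly_ring n)\<^esub> k =
    Idl\<^bsub>mpoly_ring n\<^esub> (set fs)" .
  \<comment> \<open>The common degree makes sorting by degree automatic, and
    \<open>k \<ge> 1\<close> makes it positive.\<close>
  have deg: "monom_degree (e B) = 2 * k" if "B \<in> \<B>" for B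
    using \<B>[OF that] by (simp add: e_def monom_degree_vertex_monomial size_ends)
  have total: "total_degree (monomial (e B) :: 'k mpoly) = 2 * k" if "B \<in> \<B>" for B
    using deg[OF that] by (simp add: total_degree_def)
  have "generated_by_linear_forms n
      (colon_ideal (mpoly_ring n) (Idl\<^bsub>mpoly_ring n\<^esub> (set (take j fs))) (fs ! j))"
    if j: "j < length fs" for j
  proof -
    let ?B = "l ! j"
    have jl: "j < length l" using j by (simp add: fs_def)
    then have B: "?B \<in> \<B>" using set_l nth_mem by blast
    define M where "M = e ` {A \<in> \<B>. A < ?B}"
    have "set (take j fs) = monomial ` M"
      using set_take_strict_sorted[OF sorted_l jl] by (simp add: fs_def take_map M_def image_image set_l)
    moreover have "fs ! j = monomial (e ?B)" using jl by (simp add: fs_def)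
    moreover have "generated_by_linear_forms n
      (colon_ideal (mpoly_ring n) (Idl\<^bsub>mpoly_ring n\<^esub> (monomial ` M)) (monomial (e ?B) :: 'k mpoly))"
    proof (rule colon_monomial_linear)
      show "M \<subseteq> monomials n" using e_monomials \<B> by (auto simp: M_def)
      show "e ?B \<in> monomials n" using e_monomials \<B> B by blast
      fix u assume "u \<in> M"
      then obtain A where A: "A \<in> \<B>" "A < ?B" "u = e A" by (auto simp: M_def)
      have "\<not> B' < ?B" if "set_mset B' \<subseteq> P" "ends B' = ends ?B" for B'
        using B that by (auto simp: \<B>_def least_factorizations_def)
      then obtain a b B' where swap: "count (ends ?B) a < count (ends A) a" "set_mset B' \<subseteq> P" "B' < ?B"
        "add_mset a (ends ?B) = add_mset b (ends B')"
        using exists_swap[of A ?B] \<B>[OF A(1)] \<B>[OF B] A(2) by metis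
      have "size B' = k"
        using arg_cong[OF swap(4), of size] \<B>(2)[OF B] by (simp add: size_ends)
      \<comment> \<open>\<open>B'\<close> need not be least, but the least factorization of its
        monomial lies below \<open>?B\<close> all the more, so this monomial is in
        \<open>M\<close>.\<close>
      then obtain B0 where B0: "B0 \<in> \<B>" "ends B0 = ends B'" "B0 \<le> B'"
        using exists_least_factorization[OF finP swap(2)] unfolding \<B>_def by blast
      have "a \<in># ends A" using swap(1) by (metis count_inI not_less0)
      then have "a < length vs" using ends_edge_pairs \<B>(1)[OF A(1)] P_def by blast
      then have "Poly_Mapping.lookup (e ?B) (vs ! a) < Poly_Mapping.lookup u (vs ! a)"
        using swap(1) \<B>(1)[OF A(1)] \<B>(1)[OF B]
        unfolding A(3) e_def P_def by (simp add: lookup_vertex_monomial dist ends_edge_pairs)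
      moreover have "e B0 \<in> M" using B0 swap(3) by (auto simp: M_def)
      moreover have "e ?B + Poly_Mapping.single (vs ! a) 1 = e B0 + Poly_Mapping.single (vs ! b) 1"
        using arg_cong[OF swap(4), of "vertex_monomial vs"] B0(2) by (simp add: e_def add.commute)
      ultimately show "\<exists>a. Poly_Mapping.lookup (e ?B) a < Poly_Mapping.lookup u a \<and>
          (\<exists>u'\<in>M. \<exists>w. e ?B + Poly_Mapping.single a 1 = u' + w)" by blast
    qed
    ultimately show ?thesis by simp
  qed
  moreover have "set fs \<subseteq> carrier (mpoly_ring n)"
    using e_monomials \<B> by (auto simp: fs_def set_l monomial_carrier)
  moreover have "\<forall>f\<in>set fs. (\<exists>d. homogeneous d f) \<and> 0 < total_degree f"
    using total assms(3) by (auto simp: fs_def set_l homogeneous_def)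
  moreover have "sorted (map total_degree fs)"
    using total set_l by (auto simp: fs_def sorted_iff_nth_mono)
  ultimately show ?thesis
    using gens unfolding has_linear_quotients_def linear_quotients_seq_def by blast
qed

end
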